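(* Let $f$ satisfy assumptions (A1)–(A4) of the context and be $(\alpha,\beta,\gamma)$-strict-minimax for some $\alpha,\beta,\gamma>0$. Let $M=4\sqrt2\,\kappa^3\rho$, $C_g=1/192$, $C_H=1/48$, $\varepsilon=\min\{\alpha/3,\ \beta^2/(8\kappa^3\rho)\}$, $\varepsilon'=2^{-2.5}\varepsilon$ and $\tilde\varepsilon'=\min\{C_g\varepsilon'/\ell,\ C_H\sqrt{M\varepsilon'}/\rho\}$. Let $\hat{\mathbf x}$ be the output of the algorithm MCN (see context) run with tolerance $\varepsilon'$, $T=\big\lceil 192(P(\mathbf x_0)-P^* )\sqrt M\,\varepsilon'^{-1.5}\big\rceil+1$, $K_0=\Big\lceil2\sqrt\kappa\log\big(\frac{\sqrt{\kappa+1}}{\tilde\varepsilon'}\|\mathbf y^*(\mathbf x_0)\|_2\big)\Big\rceil$ and $K_t=\Big\lceil2\sqrt\kappa\log\big(\frac{\sqrt{\kappa+1}}{\tilde\varepsilon'}(\tilde\varepsilon'+\kappa\|\mathbf s_{t-1}^*\|_2)\big)\Big\rceil$ for $t\ge1$. Let $t$ be the index of the last iteration of MCN, so that $\hat{\mathbf x}=\mathbf x_t+\mathbf s_t^*$, and let $$\hat{\mathbf y}=\mathrm{AGD}\Big(-f(\hat{\mathbf x},\cdot),\ \mathbf y_t,\ \hat K,\ \frac1\ell,\ \frac{\sqrt\kappa-1}{\sqrt\kappa+1}\Big),\qquad \hat K=\Bigg\lceil2\sqrt\kappa\,\log\Bigg(\frac{\sqrt{\kappa+1}\,\big(\tilde\varepsilon'+\frac{\kappa}{2^{2.25}}\sqrt{\varepsilon/M}\,\big)}{\min\{\frac{\alpha}{2\ell},\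 \frac{\beta}{8\kappa^2\rho}\}}\Bigg)\Bigg\rceil.$$ Then there exists a local minimax point $(\mathbf x^*,\mathbf y^* )$ of $f$ such that $\|\mathbf x^*-\hat{\mathbf x}\|_2^2+\|\mathbf y^*-\hat{\mathbf y}\|_2^2\le\gamma^2$.
   Context: Notation: $\|\cdot\|_2$ is the Euclidean norm of vectors and the spectral norm of matrices. $f:\mathbb R^{d_x}\times\mathbb R^{d_y}\to\mathbb R$ is twice differentiable. Assumptions, with constants $\ell,\rho,\mu>0$: (A1) $\|\nabla f(\mathbf x,\mathbf y)-\nabla f(\mathbf x',\mathbf y')\|_2^2\le \ell^2(\|\mathbf x-\mathbf x'\|_2^2+\|\mathbf y-\mathbf y'\|_2^2)$ for all $\mathbf x,\mathbf x',\mathbf y,\mathbf y'$; (A2) $\|\nabla^2 f(\mathbf x,\mathbf y)-\nabla^2 f(\mathbf x',\mathbf y')\|_2^2\le \rho^2(\|\mathbf x-\mathbf x'\|_2^2+\|\mathbf y-\mathbf y'\|_2^2)$ for all $\mathbf x,\mathbf x',\mathbf y,\mathbf y'$; (A3) $f$ is $\mu$-strongly concave in $\mathbf y$: $f(\mathbf x,\mathbf y)\le f(\mathbf x,\mathbf y')+\nabla_y f(\mathbf x,\mathbf y')^\top(\mathbf y-\mathbf y')-\frac{\mu}{2}\|\mathbf y-\mathbf y'\|_2^2$ for all $\mathbf x,\mathbf y,\mathbf y'$; (A4) $P(\mathbf x)=\max_{\mathbf y\in\mathbb R^{d_y}}f(\mathbf x,\mathbf y)$ satisfies $P^*=\inf_{\mathbf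 x}P(\mathbf x)>-\infty$. Put $\kappa=\ell/\mu$, $\mathbf y^*(\mathbf x)=\arg\max_{\mathbf y}f(\mathbf x,\mathbf y)$, and $\mathbf H(\mathbf x,\mathbf y)=\nabla_{xx}^2f(\mathbf x,\mathbf y)-\nabla_{xy}^2f(\mathbf x,\mathbf y)\big(\nabla_{yy}^2f(\mathbf x,\mathbf y)\big)^{-1}\nabla_{yx}^2f(\mathbf x,\mathbf y)$. Local minimax point: $(\mathbf x^*,\mathbf y^* )$ is a local minimax point of $f$ if there exist $\delta_0>0$ and a function $h$ with $h(\delta)\to0$ as $\delta\to0$ such that for every $\delta\in(0,\delta_0]$, every $\mathbf x$ with $\|\mathbf x-\mathbf x^*\|_2\le h(\delta)$ and every $\mathbf y\in\mathbb R^{d_y}$: $f(\mathbf x^*,\mathbf y)\le f(\mathbf x^*,\mathbf y^* )\le\max_{\mathbf y'\in\mathbb R^{d_y}}f(\mathbf x,\mathbf y')$. Strict-minimax: $f$ is $(\alpha,\beta,\gamma)$-strict-minimax if every $(\hat{\mathbf x},\hat{\mathbf y})\in\mathbb R^{d_x}\times\mathbb R^{d_y}$ satisfies at least one of: (a) $\|\nabla f(\hat{\mathbf x},\hat{\mathbf y})\|_2>\alpha$; (b) $\lambda_{\min}(\mathbf H(\hat{\mathbf x},\hat{\mathbf y}))<-\beta$; (c) there is a local minimax point $(\mathbf x^*,\mathbf y^* )$ with $\|\hat{\mathbf x}-\mathbf x^*\|_2^2+\|\hat{\mathbf y}-\mathbf y^*\|_2^2\le\gamma^2$. AGD$(h,\mathbf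 y_0,K,\eta,\theta)$: set $\tilde{\mathbf y}_0=\mathbf y_0$; for $k=0,\dots,K-1$ set $\mathbf y_{k+1}=\tilde{\mathbf y}_k-\eta\nabla h(\tilde{\mathbf y}_k)$, $\tilde{\mathbf y}_{k+1}=\mathbf y_{k+1}+\theta(\mathbf y_{k+1}-\mathbf y_k)$; return $\mathbf y_K$ (no step is performed, and $\mathbf y_0$ is returned, if $K\le 0$). MCN (Minimax Cubic Newton), with inputs $\mathbf x_0\in\mathbb R^{d_x}$, $\mathbf y_{-1}=\mathbf 0$, $T$, $\{K_t\}$ and a tolerance $\epsilon$: for $t=0,\dots,T-1$: $\mathbf y_t=\mathrm{AGD}\big(-f(\mathbf x_t,\cdot),\mathbf y_{t-1},K_t,\frac1\ell,\frac{\sqrt\kappa-1}{\sqrt\kappa+1}\big)$; $\mathbf g_t=\nabla_xf(\mathbf x_t,\mathbf y_t)$, $\mathbf H_t=\mathbf H(\mathbf x_t,\mathbf y_t)$; $\mathbf s_t^*\in\arg\min_{\mathbf s\in\mathbb R^{d_x}}\big(\mathbf g_t^\top\mathbf s+\frac12\mathbf s^\top\mathbf H_t\mathbf s+\frac M6\|\mathbf s\|_2^3\big)$; if $\|\mathbf s_t^*\|_2\le\frac12\sqrt{\epsilon/M}$ then exit the loop; otherwise $\mathbf x_{t+1}=\mathbf x_t+\mathbf s_t^*$. The output is $\hat{\mathbf x}=\mathbf x_t+\mathbf s_t^*$ for the last $t$ executed. *)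

theory Defs
  imports "HOL-Analysis.Analysis"
begin

definition grad :: "('a::real_inner \<Rightarrow> real) \<Rightarrow> 'a \<Rightarrow> 'a" where
  "grad f z = (THE D. GDERIV f z :> D)"

text \<open>The Hessian is kept as a linear map, so that its spectral norm is \<open>onorm\<close>.\<close>

definition hess :: "('a::real_inner \<Rightarrow> real) \<Rightarrow> 'a \<Rightarrow> 'a \<Rightarrow> 'a" where
  "hess f z = frechet_derivative (grad f) (at z)"

definition twice_differentiable :: "('a::real_inner \<Rightarrow> real) \<Rightarrow> bool" where
  "twice_differentiable f \<longleftrightarrow>
     (\<forall>z. f differentiable (at z)) \<and> (\<forall>z. grad f differentiable (at z))"

definition grad_x :: "((real^'n) \<times> (real^'m) \<Rightarrow> real) \<Rightarrow> real^'n \<Rightarrow> real^'m \<Rightarrow> real^'n" where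
  "grad_x f x y = grad (\<lambda>x'. f (x', y)) x"

definition grad_y :: "((real^'n) \<times> (real^'m) \<Rightarrow> real) \<Rightarrow> real^'n \<Rightarrow> real^'m \<Rightarrow> real^'m" where
  "grad_y f x y = grad (\<lambda>y'. f (x, y')) y"

definition hess_xx :: "((real^'n) \<times> (real^'m) \<Rightarrow> real) \<Rightarrow> real^'n \<Rightarrow> real^'m \<Rightarrow> real^'n^'n" where
  "hess_xx f x y = matrix (\<lambda>u. fst (hess f (x, y) (u, 0)))"

definition hess_xy :: "((real^'n) \<times> (real^'m) \<Rightarrow> real) \<Rightarrow> real^'n \<Rightarrow> real^'m \<Rightarrow> real^'m^'n" where
  "hess_xy f x y = matrix (\<lambda>v. fst (hess f (x, y) (0, v)))"

definition hess_yx :: "((real^'n) \<times> (real^'m) \<Rightarrow> real) \<Rightarrow> real^'n \<Rightarrow> real^'m \<Rightarrow> real^'n^'m" where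
  "hess_yx f x y = matrix (\<lambda>u. snd (hess f (x, y) (u, 0)))"

definition hess_yy :: "((real^'n) \<times> (real^'m) \<Rightarrow> real) \<Rightarrow> real^'n \<Rightarrow> real^'m \<Rightarrow> real^'m^'m" where
  "hess_yy f x y = matrix (\<lambda>v. snd (hess f (x, y) (0, v)))"

definition minimax_hess :: "((real^'n) \<times> (real^'m) \<Rightarrow> real) \<Rightarrow> real^'n \<Rightarrow> real^'m \<Rightarrow> real^'n^'n" where
  "minimax_hess f x y =
     hess_xx f x y - hess_xy f x y ** matrix_inv (hess_yy f x y) ** hess_yx f x y"

text \<open>Intended for symmetric matrices; the set of real eigenvalues is then finite and nonempty.\<close>

definition lambda_min :: "real^'n^'n \<Rightarrow> real" where
  "lambda_min A = Min {e. \<exists>v. v \<noteq> 0 \<and> A *v v = e *\<^sub>R v}"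

text \<open>If \<open>f\<close> is strongly concave in its second argument, as in all uses below, the supremum is
  attained, at the unique point \<open>argmax_y f x\<close>.\<close>

definition max_y :: "((real^'n) \<times> (real^'m) \<Rightarrow> real) \<Rightarrow> real^'n \<Rightarrow> real" where
  "max_y f x = (SUP y. f (x, y))"

definition argmax_y :: "((real^'n) \<times> (real^'m) \<Rightarrow> real) \<Rightarrow> real^'n \<Rightarrow> real^'m" where
  "argmax_y f x = arg_max (\<lambda>y. f (x, y)) (\<lambda>_. True)"

text \<open>The radius function \<open>h\<close> has to be positive: for negative \<open>h\<close> every point would qualify
  vacuously, and \<open>h = 0\<close> would impose no condition on \<open>x \<noteq> xs\<close>.\<close>

definition local_minimax_point ::
    "((real^'n) \<times> (real^'m) \<Rightarrow> real) \<Rightarrow> real^'n \<Rightarrow> real^'m \<Rightarrow> bool" where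
  "local_minimax_point f xs ys \<longleftrightarrow>
     (\<exists>\<delta>0>0. \<exists>h::real \<Rightarrow> real. (h \<longlongrightarrow> 0) (at_right 0) \<and>
       (\<forall>\<delta>\<in>{0<..\<delta>0}. h \<delta> > 0 \<and>
         (\<forall>x y. norm (x - xs) \<le> h \<delta> \<longrightarrow>
            f (xs, y) \<le> f (xs, ys) \<and> f (xs, ys) \<le> max_y f x)))"

definition strict_minimax ::
    "((real^'n) \<times> (real^'m) \<Rightarrow> real) \<Rightarrow> real \<Rightarrow> real \<Rightarrow> real \<Rightarrow> bool" where
  "strict_minimax f \<alpha> \<beta> \<gamma> \<longleftrightarrow>
     (\<forall>xh yh. norm (grad f (xh, yh)) > \<alpha> \<or>
              lambda_min (minimax_hess f xh yh) < - \<beta> \<or>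
              (\<exists>xs ys. local_minimax_point f xs ys \<and>
                 (norm (xh - xs))\<^sup>2 + (norm (yh - ys))\<^sup>2 \<le> \<gamma>\<^sup>2))"

text \<open>The \<open>k\<close>-th element is the pair of the iterate and the extrapolated iterate.\<close>

primrec agd_iter ::
    "('a::real_inner \<Rightarrow> real) \<Rightarrow> 'a \<Rightarrow> real \<Rightarrow> real \<Rightarrow> nat \<Rightarrow> 'a \<times> 'a" where
  "agd_iter h y0 \<eta> \<theta> 0 = (y0, y0)"
| "agd_iter h y0 \<eta> \<theta> (Suc k) =
     (let (y, yt) = agd_iter h y0 \<eta> \<theta> k;
          y' = yt - \<eta> *\<^sub>R grad h yt
      in (y', y' + \<theta> *\<^sub>R (y' - y)))"

definition agd :: "('a::real_inner \<Rightarrow> real) \<Rightarrow> 'a \<Rightarrow> int \<Rightarrow> real \<Rightarrow> real \<Rightarrow> 'a" where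
  "agd h y0 K \<eta> \<theta> = fst (agd_iter h y0 \<eta> \<theta> (nat K))"

definition cubic_model :: "real^'n \<Rightarrow> real^'n^'n \<Rightarrow> real \<Rightarrow> real^'n \<Rightarrow> real" where
  "cubic_model g H M s = g \<bullet> s + (1/2) * (s \<bullet> (H *v s)) + M / 6 * norm s ^ 3"

text \<open>\<open>mcn_run f L \<kappa> M \<epsilon> T K x0 x y s t\<close>: the sequences \<open>x\<close>, \<open>y\<close>, \<open>s\<close> form, up to index \<open>t\<close>,
  a complete execution of the algorithm whose last iteration has index \<open>t\<close>. It is a relation
  because any minimiser of the cubic model may be chosen in each iteration. The values of the
  sequences beyond \<open>t\<close> are irrelevant.\<close>

definition mcn_run ::
    "((real^'n) \<times> (real^'m) \<Rightarrow> real) \<Rightarrow> real \<Rightarrow> real \<Rightarrow> real \<Rightarrow> real \<Rightarrow> nat \<Rightarrow> (nat \<Rightarrow> int) \<Rightarrow> real^'n \<Rightarrow>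
     (nat \<Rightarrow> real^'n) \<Rightarrow> (nat \<Rightarrow> real^'m) \<Rightarrow> (nat \<Rightarrow> real^'n) \<Rightarrow> nat \<Rightarrow> bool" where
  "mcn_run f L \<kappa> M \<epsilon> T K x0 x y s t \<longleftrightarrow>
     t < T \<and> x 0 = x0 \<and>
     (\<forall>k\<le>t. y k = agd (\<lambda>v. - f (x k, v)) (if k = 0 then 0 else y (k - 1)) (K k)
                     (1 / L) ((sqrt \<kappa> - 1) / (sqrt \<kappa> + 1))) \<and>
     (\<forall>k\<le>t. is_arg_min (cubic_model (grad_x f (x k) (y k)) (minimax_hess f (x k) (y k)) M)
                     (\<lambda>_. True) (s k)) \<and>
     (\<forall>k<t. \<not> norm (s k) \<le> (1/2) * sqrt (\<epsilon> / M) \<and> x (Suc k) = x k + s k) \<and>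
     (norm (s t) \<le> (1/2) * sqrt (\<epsilon> / M) \<or> Suc t = T)"

end

theory Submission
  imports Defs
begin

text \<open>
  Let \<open>y\<^sup>*(x)\<close> be the maximiser of \<open>f (x, _)\<close>, let \<open>P x = f (x, y\<^sup>*(x))\<close>, and let
  \<open>G x\<close> be the \<open>x\<close>-gradient of \<open>f\<close> at \<open>(x, y\<^sup>*(x))\<close>. The algorithm is an inexact cubic Newton method
  for \<open>P\<close>, and it suffices to show that its output is so close to a second-order stationary point
  that the first two alternatives of the strict minimax property fail; the third one is the claim.

  The textbook route differentiates \<open>P\<close> twice through the implicit function theorem. It is bypassed
  here, because all information about \<open>P\<close> can be read off the Hessian form of \<open>f\<close>. The Schur
  complement \<open>H\<close> satisfies \<open>u \<bullet> H u = max\<^sub>v (u, v) \<bullet> \<nabla>\<^sup>2f (u, v)\<close>, because the form is negative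
  definite in \<open>v\<close>, and the maximum is attained at a \<open>v\<close> with \<open>|v| \<le> \<kappa> |u|\<close> for which
  \<open>\<nabla>\<^sup>2f (u, v) = (H u, 0)\<close> (\<open>hess_lift\<close>, \<open>hess_quadratic_le_minimax_hess\<close>). Symmetry, boundedness and the
  Lipschitz continuity of \<open>H\<close> follow at once. Moreover, Taylor expansion of \<open>f\<close> itself between
  \<open>(x, y\<^sup>*(x))\<close> and \<open>(x + s, y\<^sup>*(x + s))\<close>, two points at distance at most \<open>\<surd>2 \<kappa> |s|\<close>, yields
  \<open>P (x + s) \<le> P x + s \<bullet> G x + 1/2 s \<bullet> H s + M/12 |s|\<^sup>3\<close> and \<open>|G (x + s) - G x - H s| \<le> M/4 |s|\<^sup>2\<close>
  (\<open>max_y_cubic_upper\<close>, \<open>primal_grad_taylor\<close>).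

  Accelerated gradient descent contracts a potential by \<open>1 - 1/\<surd>\<kappa>\<close> per step
  (\<open>agd_linear_convergence\<close>), so the prescribed inner iteration numbers keep \<open>y\<^sub>k\<close> within the tolerance
  of \<open>y\<^sup>*(x\<^sub>k)\<close> (\<open>mcn_inner_accuracy\<close>). With such \<open>y\<^sub>k\<close> every long step decreases \<open>P\<close> by at least
  \<open>e\<^sup>3\<^sup>/\<^sup>2 / (128 \<surd>M)\<close>, where \<open>e\<close> is the tolerance of the run (\<open>long_step_decrease\<close>). As \<open>P\<close> is bounded
  below, the iteration budget forces the last step to be short (\<open>mcn_last_step_short\<close>), and a short
  step leads to a point with \<open>|G| \<le> e\<close> and \<open>H \<ge> - \<surd>(M e)\<close> (\<open>short_step_stationary\<close>). The constants are such
  that \<open>3 e \<le> \<alpha>\<close> and \<open>\<surd>(M e) \<le> \<beta>/2\<close>, and the final run of accelerated gradient descent is accurate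
  enough to transfer both bounds, with the remaining slack, to the computed point.
\<close>

section \<open>Gradients and Taylor bounds\<close>

text \<open>
  The definite description in \<open>grad\<close> is justified by the Riesz representation of the derivative.
\<close>

lemma has_derivative_grad:
  fixes f :: "'a::euclidean_space \<Rightarrow> real"
  assumes "f differentiable (at z)"
  shows "(f has_derivative (\<lambda>h. h \<bullet> grad f z)) (at z)"
proof -
  obtain f' where f': "(f has_derivative f') (at z)"
    using assms by (auto simp: differentiable_def)
  interpret f': bounded_linear f' by (rule has_derivative_bounded_linear[OF f'])
  define D where "D = (\<Sum>b\<in>Basis. f' b *\<^sub>R b)"
  have "f' h = h \<bullet> D" for h
  proof -
    have "f' h = f' (\<Sum>b\<in>Basis. (h \<bullet> b) *\<^sub>R b)" by (simp add: euclidean_representation)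
    also have "\<dots> = h \<bullet> D"
      by (simp add: D_def f'.sum f'.scaleR inner_sum_right mult.commute)
    finally show ?thesis .
  qed
  then have "f' = (\<lambda>h. h \<bullet> D)" by (rule ext)
  then have D: "GDERIV f z :> D" using f' by (simp add: gderiv_def)
  moreover have "D' = D" if "GDERIV f z :> D'" for D'
    using has_derivative_unique[OF that[unfolded gderiv_def] D[unfolded gderiv_def]]
    by (metis inner_commute vector_eq_rdot)
  ultimately have "GDERIV f z :> grad f z" unfolding grad_def by (rule theI)
  then show ?thesis by (simp add: gderiv_def)
qed

lemma grad_eqI:
  fixes f :: "'a::euclidean_space \<Rightarrow> real"
  assumes "(f has_derivative (\<lambda>h. h \<bullet> D)) (at z)"
  shows "grad f z = D"
proof -
  have "(f has_derivative (\<lambda>h. h \<bullet> grad f z)) (at z)"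
    using assms by (intro has_derivative_grad) (auto simp: differentiable_def)
  from has_derivative_unique[OF this assms] show ?thesis
    by (metis inner_commute vector_eq_rdot)
qed

lemma has_real_derivative_along_line:
  fixes f :: "'a::real_inner \<Rightarrow> real"
  assumes "\<And>z. (f has_derivative (\<lambda>h. h \<bullet> g z)) (at z)"
  shows "((\<lambda>\<tau>. f (z + \<tau> *\<^sub>R d)) has_real_derivative d \<bullet> g (z + \<tau> *\<^sub>R d)) (at \<tau>)"
proof -
  have "((\<lambda>\<tau>. z + \<tau> *\<^sub>R d) has_derivative (\<lambda>h. h *\<^sub>R d)) (at \<tau>)"
    by (auto intro!: derivative_eq_intros)
  from has_derivative_compose[OF this assms] show ?thesis
    by (simp add: has_field_derivative_def mult_commute_abs)
qed

lemma has_vector_derivative_along_line: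
  fixes g :: "'a::real_normed_vector \<Rightarrow> 'b::real_normed_vector"
  assumes "\<And>z. (g has_derivative H z) (at z)"
  shows "((\<lambda>\<tau>. g (z + \<tau> *\<^sub>R d)) has_vector_derivative H (z + \<tau> *\<^sub>R d) d) (at \<tau>)"
proof -
  have "((\<lambda>\<tau>. z + \<tau> *\<^sub>R d) has_derivative (\<lambda>h. h *\<^sub>R d)) (at \<tau>)"
    by (auto intro!: derivative_eq_intros)
  from has_derivative_compose[OF this assms[of "z + \<tau> *\<^sub>R d"]] show ?thesis
    by (simp add: has_vector_derivative_def linear_cmul[OF has_derivative_linear[OF assms]])
qed

text \<open>
  The difference of the two sides along the segment from \<open>z\<close> to \<open>z + d\<close> has a derivative of constant
  sign. The Taylor bounds below are proved in the same way, which needs no integrability of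
  derivatives.
\<close>

lemma value_le_of_lipschitz_gradient:
  fixes h :: "'a::real_inner \<Rightarrow> real"
  assumes deriv: "\<And>z. (h has_derivative (\<lambda>d. d \<bullet> g z)) (at z)"
    and lip: "\<And>z z'. norm (g z - g z') \<le> L * norm (z - z')"
  shows "h (z + d) \<le> h z + d \<bullet> g z + L / 2 * (norm d)\<^sup>2"
proof -
  define \<phi> where "\<phi> \<tau> = h (z + \<tau> *\<^sub>R d) - \<tau> * (d \<bullet> g z) - L / 2 * \<tau>\<^sup>2 * (norm d)\<^sup>2" for \<tau>
  have "\<phi> 1 \<le> \<phi> 0"
  proof (rule DERIV_nonpos_imp_nonincreasing[of 0 1 \<phi>])
    fix \<tau> :: real assume "0 \<le> \<tau>" "\<tau> \<le> 1"
    have "(\<phi> has_real_derivative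
        d \<bullet> g (z + \<tau> *\<^sub>R d) - d \<bullet> g z - L * \<tau> * (norm d)\<^sup>2) (at \<tau>)"
      unfolding \<phi>_def
      by (auto intro!: derivative_eq_intros has_real_derivative_along_line[OF deriv])
    moreover have "d \<bullet> g (z + \<tau> *\<^sub>R d) - d \<bullet> g z \<le> L * \<tau> * (norm d)\<^sup>2"
    proof -
      have "d \<bullet> (g (z + \<tau> *\<^sub>R d) - g z) \<le> norm d * norm (g (z + \<tau> *\<^sub>R d) - g z)"
        by (rule norm_cauchy_schwarz)
      also have "\<dots> \<le> norm d * (L * norm (z + \<tau> *\<^sub>R d - z))"
        by (intro mult_left_mono lip) simp
      also have "\<dots> = L * \<tau> * (norm d)\<^sup>2"
        using \<open>0 \<le> \<tau>\<close> by (simp add: power2_eq_square)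
      finally show ?thesis by (simp add: inner_diff_right)
    qed
    ultimately show "\<exists>y. (\<phi> has_real_derivative y) (at \<tau>) \<and> y \<le> 0" by fastforce
  qed simp
  then show ?thesis by (simp add: \<phi>_def)
qed

text \<open>
  The vector-valued remainder is tested against itself, which reduces the claim to a scalar function
  of the segment parameter.
\<close>

lemma gradient_taylor_bound:
  fixes g :: "'a::real_normed_vector \<Rightarrow> 'b::real_inner"
  assumes deriv: "\<And>z. (g has_derivative H z) (at z)"
    and lip: "\<And>z z' w. norm (H z w - H z' w) \<le> \<rho> * norm (z - z') * norm w"
  shows "norm (g (z + d) - g z - H z d) \<le> \<rho> / 2 * (norm d)\<^sup>2"
proof -
  define w where "w = g (z + d) - g z - H z d"
  define \<phi> where "\<phi> \<tau> = w \<bullet> g (z + \<tau> *\<^sub>R d) - \<tau> * (w \<bullet> H z d)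
      - norm w * (\<rho> / 2) * \<tau>\<^sup>2 * (norm d)\<^sup>2" for \<tau>
  have "\<phi> 1 \<le> \<phi> 0"
  proof (rule DERIV_nonpos_imp_nonincreasing[of 0 1 \<phi>])
    fix \<tau> :: real assume "0 \<le> \<tau>" "\<tau> \<le> 1"
    have "((\<lambda>\<tau>. w \<bullet> g (z + \<tau> *\<^sub>R d)) has_real_derivative w \<bullet> H (z + \<tau> *\<^sub>R d) d) (at \<tau>)"
      using has_vector_derivative_along_line[OF deriv, of z d \<tau>]
      unfolding has_real_derivative_iff_has_vector_derivative
      by (rule bounded_linear.has_vector_derivative[OF bounded_linear_inner_right])
    then have "(\<phi> has_real_derivative
        w \<bullet> H (z + \<tau> *\<^sub>R d) d - w \<bullet> H z d - norm w * \<rho> * \<tau> * (norm d)\<^sup>2) (at \<tau>)"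
      unfolding \<phi>_def by (auto intro!: derivative_eq_intros)
    moreover have "w \<bullet> H (z + \<tau> *\<^sub>R d) d - w \<bullet> H z d \<le> norm w * \<rho> * \<tau> * (norm d)\<^sup>2"
    proof -
      have "w \<bullet> (H (z + \<tau> *\<^sub>R d) d - H z d) \<le> norm w * norm (H (z + \<tau> *\<^sub>R d) d - H z d)"
        by (rule norm_cauchy_schwarz)
      also have "\<dots> \<le> norm w * (\<rho> * norm (z + \<tau> *\<^sub>R d - z) * norm d)"
        by (intro mult_left_mono lip) simp
      also have "\<dots> = norm w * \<rho> * \<tau> * (norm d)\<^sup>2"
        using \<open>0 \<le> \<tau>\<close> by (simp add: power2_eq_square)
      finally show ?thesis by (simp add: inner_diff_right)
    qed
    ultimately show "\<exists>y. (\<phi> has_real_derivative y) (at \<tau>) \<and> y \<le> 0" by fastforce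
  qed simp
  then have "w \<bullet> w \<le> norm w * (\<rho> / 2 * (norm d)\<^sup>2)"
    by (simp add: \<phi>_def w_def inner_diff_right)
  then have "norm w * norm w \<le> norm w * (\<rho> / 2 * (norm d)\<^sup>2)"
    by (simp add: power2_norm_eq_inner[symmetric] power2_eq_square)
  moreover have "0 \<le> \<rho> / 2 * (norm d)\<^sup>2"
  proof -
    have "0 \<le> \<rho> * norm ((z + d) - z) * norm d"
      by (rule order_trans[OF norm_ge_zero lip[of "z + d" d z]])
    then show ?thesis by (simp add: power2_eq_square)
  qed
  ultimately show ?thesis
    unfolding w_def[symmetric] by (cases "norm w = 0") (auto simp: mult_le_cancel_left)
qed

lemma value_taylor_upper:
  fixes f :: "'a::real_inner \<Rightarrow> real"
  assumes deriv_f: "\<And>z. (f has_derivative (\<lambda>d. d \<bullet> g z)) (at z)"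
    and deriv: "\<And>z. (g has_derivative H z) (at z)"
    and lip: "\<And>z z' w. norm (H z w - H z' w) \<le> \<rho> * norm (z - z') * norm w"
  shows "f (z + d) \<le> f z + d \<bullet> g z + 1/2 * (d \<bullet> H z d) + \<rho> / 6 * norm d ^ 3"
proof -
  define \<phi> where "\<phi> \<tau> = f (z + \<tau> *\<^sub>R d) - \<tau> * (d \<bullet> g z) - \<tau>\<^sup>2 / 2 * (d \<bullet> H z d)
      - \<tau> ^ 3 * (\<rho> / 6 * norm d ^ 3)" for \<tau>
  have "\<phi> 1 \<le> \<phi> 0"
  proof (rule DERIV_nonpos_imp_nonincreasing[of 0 1 \<phi>])
    fix \<tau> :: real assume "0 \<le> \<tau>" "\<tau> \<le> 1"
    have "(\<phi> has_real_derivative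
        d \<bullet> g (z + \<tau> *\<^sub>R d) - d \<bullet> g z - \<tau> * (d \<bullet> H z d) - \<tau>\<^sup>2 * (\<rho> / 2 * norm d ^ 3)) (at \<tau>)"
      unfolding \<phi>_def
      by (auto intro!: derivative_eq_intros has_real_derivative_along_line[OF deriv_f])
    moreover have "d \<bullet> g (z + \<tau> *\<^sub>R d) - d \<bullet> g z - \<tau> * (d \<bullet> H z d)
        \<le> \<tau>\<^sup>2 * (\<rho> / 2 * norm d ^ 3)"
    proof -
      have "d \<bullet> (g (z + \<tau> *\<^sub>R d) - g z - H z (\<tau> *\<^sub>R d))
          \<le> norm d * norm (g (z + \<tau> *\<^sub>R d) - g z - H z (\<tau> *\<^sub>R d))"
        by (rule norm_cauchy_schwarz)
      also have "\<dots> \<le> norm d * (\<rho> / 2 * (norm (\<tau> *\<^sub>R d))\<^sup>2)"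
        by (intro mult_left_mono gradient_taylor_bound[OF deriv lip]) simp
      also have "\<dots> = \<tau>\<^sup>2 * (\<rho> / 2 * norm d ^ 3)"
        by (simp add: power_mult_distrib power2_eq_square power3_eq_cube)
      finally show ?thesis
        by (simp add: inner_diff_right linear_cmul[OF has_derivative_linear[OF deriv]])
    qed
    ultimately show "\<exists>y. (\<phi> has_real_derivative y) (at \<tau>) \<and> y \<le> 0" by fastforce
  qed simp
  then show ?thesis by (simp add: \<phi>_def)
qed

text \<open>
  Symmetry of second derivatives comes from the second difference of \<open>f\<close>, which is symmetric in
  \<open>a\<close> and \<open>b\<close> and agrees with \<open>a \<bullet> H z b\<close> up to an error of third order.
\<close>

lemma second_difference_bound:
  fixes f :: "'a::real_inner \<Rightarrow> real"
  assumes deriv_f: "\<And>z. (f has_derivative (\<lambda>d. d \<bullet> g z)) (at z)"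
    and deriv: "\<And>z. (g has_derivative H z) (at z)"
    and lip: "\<And>z z' w. norm (H z w - H z' w) \<le> \<rho> * norm (z - z') * norm w"
    and "0 \<le> \<rho>"
  shows "f (z + a + b) - f (z + a) - f (z + b) + f z - a \<bullet> H z b
           \<le> \<rho> * norm a * (norm a + norm b)\<^sup>2"
proof -
  define \<phi> where "\<phi> \<tau> = f ((z + b) + \<tau> *\<^sub>R a) - f (z + \<tau> *\<^sub>R a) - \<tau> * (a \<bullet> H z b)
      - \<tau> * (\<rho> * norm a * (norm a + norm b)\<^sup>2)" for \<tau>
  have "\<phi> 1 \<le> \<phi> 0"
  proof (rule DERIV_nonpos_imp_nonincreasing[of 0 1 \<phi>])
    fix \<tau> :: real assume \<tau>: "0 \<le> \<tau>" "\<tau> \<le> 1"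
    have "(\<phi> has_real_derivative a \<bullet> g ((z + b) + \<tau> *\<^sub>R a) - a \<bullet> g (z + \<tau> *\<^sub>R a)
        - a \<bullet> H z b - \<rho> * norm a * (norm a + norm b)\<^sup>2) (at \<tau>)"
      unfolding \<phi>_def
      by (auto intro!: derivative_eq_intros has_real_derivative_along_line[OF deriv_f])
    moreover have "a \<bullet> g ((z + b) + \<tau> *\<^sub>R a) - a \<bullet> g (z + \<tau> *\<^sub>R a) - a \<bullet> H z b
        \<le> \<rho> * norm a * (norm a + norm b)\<^sup>2"
    proof -
      let ?R = "\<lambda>d. g (z + d) - g z - H z d"
      have R: "norm (?R d) \<le> \<rho> / 2 * (norm a + norm b)\<^sup>2" if "norm d \<le> norm a + norm b" for d
      proof -
        have "norm (?R d) \<le> \<rho> / 2 * (norm d)\<^sup>2" by (rule gradient_taylor_bound[OF deriv lip])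
        also have "\<dots> \<le> \<rho> / 2 * (norm a + norm b)\<^sup>2"
          using that \<open>0 \<le> \<rho>\<close> by (intro mult_left_mono power_mono) auto
        finally show ?thesis .
      qed
      have ta: "norm (\<tau> *\<^sub>R a) \<le> norm a" using \<tau> by (simp add: mult_left_le_one_le)
      have "norm (b + \<tau> *\<^sub>R a) \<le> norm a + norm b"
        using norm_triangle_ineq[of b "\<tau> *\<^sub>R a"] ta by linarith
      note R1 = R[OF this]
      have "norm (\<tau> *\<^sub>R a) \<le> norm a + norm b" using ta norm_ge_zero[of b] by linarith
      note R2 = R[OF this]
      have "norm (?R (b + \<tau> *\<^sub>R a) - ?R (\<tau> *\<^sub>R a)) \<le> \<rho> * (norm a + norm b)\<^sup>2"
        using norm_triangle_ineq4[of "?R (b + \<tau> *\<^sub>R a)" "?R (\<tau> *\<^sub>R a)"] R1 R2 by linarith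
      then have "a \<bullet> (?R (b + \<tau> *\<^sub>R a) - ?R (\<tau> *\<^sub>R a)) \<le> norm a * (\<rho> * (norm a + norm b)\<^sup>2)"
        by (intro order_trans[OF norm_cauchy_schwarz] mult_left_mono) auto
      then show ?thesis
        by (simp add: inner_diff_right linear_add[OF has_derivative_linear[OF deriv]]
            inner_add_right algebra_simps)
    qed
    ultimately show "\<exists>y. (\<phi> has_real_derivative y) (at \<tau>) \<and> y \<le> 0" by fastforce
  qed simp
  then show ?thesis by (simp add: \<phi>_def algebra_simps)
qed

text \<open>
  This carries out the limits \<open>t \<rightarrow> 0\<close> in all comparisons of orders below.
\<close>

lemma le_zero_if_le_scaled:
  fixes a C :: real
  assumes "\<And>t. 0 < t \<Longrightarrow> t \<le> 1 \<Longrightarrow> a \<le> t * C"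
  shows "a \<le> 0"
proof (rule tendsto_lowerbound)
  show "((\<lambda>t. t * C) \<longlongrightarrow> 0) (at_right 0)" by (auto intro!: tendsto_eq_intros)
  show "\<forall>\<^sub>F t in at_right 0. a \<le> t * C"
    using eventually_at_right_real[of 0 "1::real", OF zero_less_one]
    by (rule eventually_mono) (auto intro: assms)
qed simp

text \<open>
  Both \<open>a \<bullet> H z b\<close> and \<open>b \<bullet> H z a\<close> approximate the same second difference of \<open>f\<close> with steps \<open>t a\<close> and
  \<open>t b\<close>; after division by \<open>t\<^sup>2\<close> the error is of order \<open>t\<close>. The missing lower estimate is the upper one
  for \<open>- f\<close>.
\<close>

lemma hessian_symmetric:
  fixes f :: "'a::real_inner \<Rightarrow> real"
  assumes deriv_f: "\<And>z. (f has_derivative (\<lambda>d. d \<bullet> g z)) (at z)"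
    and deriv: "\<And>z. (g has_derivative H z) (at z)"
    and lip: "\<And>z z' w. norm (H z w - H z' w) \<le> \<rho> * norm (z - z') * norm w"
    and rho: "0 \<le> \<rho>"
  shows "a \<bullet> H z b = b \<bullet> H z a"
proof -
  have lin: "linear (H z)" for z by (rule has_derivative_linear[OF deriv])
  have le: "a \<bullet> H z b - b \<bullet> H z a \<le> 0" for a b
  proof (rule le_zero_if_le_scaled)
    fix t :: real assume t: "0 < t"
    define S where "S = f (z + t *\<^sub>R a + t *\<^sub>R b) - f (z + t *\<^sub>R a) - f (z + t *\<^sub>R b) + f z"
    define C where "C u v = \<rho> * norm u * (norm u + norm v)\<^sup>2" for u v :: 'a
    have C: "C (t *\<^sub>R u) (t *\<^sub>R v) = t\<^sup>2 * (t * C u v)" for u v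
      using t by (simp add: C_def power2_eq_square algebra_simps)
    have "- S - t *\<^sub>R a \<bullet> - H z (t *\<^sub>R b) \<le> C (t *\<^sub>R a) (t *\<^sub>R b)"
      using second_difference_bound[where f = "\<lambda>z. - f z" and g = "\<lambda>z. - g z"
          and H = "\<lambda>z w. - H z w" and \<rho> = \<rho> and z = z and a = "t *\<^sub>R a" and b = "t *\<^sub>R b"]
        has_derivative_minus[OF deriv_f] has_derivative_minus[OF deriv] lip rho
      by (simp add: S_def C_def norm_minus_commute minus_diff_commute)
    moreover have "S - t *\<^sub>R b \<bullet> H z (t *\<^sub>R a) \<le> C (t *\<^sub>R b) (t *\<^sub>R a)"
      using second_difference_bound[OF deriv_f deriv lip rho,
          where z = z and a = "t *\<^sub>R b" and b = "t *\<^sub>R a"]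
      by (simp add: S_def C_def add.assoc add.commute[of "t *\<^sub>R b" "t *\<^sub>R a"])
    ultimately have "t\<^sup>2 * (a \<bullet> H z b - b \<bullet> H z a) \<le> t\<^sup>2 * (t * (C a b + C b a))"
      by (simp add: linear_cmul[OF lin] C power2_eq_square algebra_simps)
    then show "a \<bullet> H z b - b \<bullet> H z a \<le> t * (C a b + C b a)"
      using t by simp
  qed
  from le[of a b] le[of b a] show ?thesis by linarith
qed

section \<open>Linear convergence of accelerated gradient descent\<close>

text \<open>
  This is the contraction of the potential \<open>h y - h ys + \<mu>/2 |z - ys|\<^sup>2\<close> in one step. The new gradient point
  gains \<open>|g w|\<^sup>2 / (2 L)\<close>, which pays exactly for the quadratic gradient term in the new \<open>z\<close>, because
  \<open>a\<^sup>2 = \<mu> / L\<close>. Strong convexity at \<open>ys\<close> with weight \<open>a\<close> and at \<open>y\<close> with weight \<open>1 - a\<close> makes all terms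
  linear in the gradient cancel.
\<close>

lemma agd_potential_step:
  fixes h :: "'a::real_inner \<Rightarrow> real"
  assumes mu: "0 < \<mu>" "\<mu> \<le> L" and a: "a = sqrt (\<mu> / L)"
    and upper: "\<And>z d. h (z + d) \<le> h z + d \<bullet> g z + L / 2 * (norm d)\<^sup>2"
    and lower: "\<And>z d. h z + d \<bullet> g z + \<mu> / 2 * (norm d)\<^sup>2 \<le> h (z + d)"
    and y: "y = w - a *\<^sub>R (z - w)"
  shows "h (w - (1 / L) *\<^sub>R g w) - h ys
           + \<mu> / 2 * (norm ((1 - a) *\<^sub>R z + a *\<^sub>R w - (a / \<mu>) *\<^sub>R g w - ys))\<^sup>2
         \<le> (1 - a) * (h y - h ys + \<mu> / 2 * (norm (z - ys))\<^sup>2)"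
proof -
  define Z W G where "Z = z - ys" and "W = w - ys" and "G = g w"
  have L: "0 < L" using mu by simp
  have a0: "0 < a" "a \<le> 1" and asq: "a\<^sup>2 = \<mu> / L"
    using mu L by (auto simp: a)
  have zw: "z - w = Z - W" by (simp add: Z_def W_def)
  have descent: "h (w - (1 / L) *\<^sub>R G) \<le> h w - (G \<bullet> G) / (2 * L)"
  proof -
    have "L / 2 * (norm (- ((1 / L) *\<^sub>R G)))\<^sup>2 = (G \<bullet> G) / (2 * L)"
      using L by (simp add: power_divide power2_norm_eq_inner[symmetric] power2_eq_square)
    then show ?thesis
      using upper[of w "- ((1 / L) *\<^sub>R G)"] by (simp add: G_def[symmetric] field_simps)
  qed
  have at_opt: "h w - W \<bullet> G + \<mu> / 2 * (W \<bullet> W) \<le> h ys"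
    using lower[of w "ys - w"]
    by (simp add: G_def W_def power2_norm_eq_inner inner_diff_left inner_diff_right inner_commute
        algebra_simps)
  have at_y: "h w - a * (Z \<bullet> G - W \<bullet> G) \<le> h y"
  proof -
    have "h w + (- (a *\<^sub>R (Z - W))) \<bullet> G \<le> h (w + - (a *\<^sub>R (Z - W)))"
      using lower[of w "- (a *\<^sub>R (Z - W))"] mu
      by (smt (verit) G_def mult_nonneg_nonneg zero_le_power2 half_gt_zero)
    then show ?thesis by (simp add: y zw inner_diff_left)
  qed
  define N where "N = (norm ((1 - a) *\<^sub>R z + a *\<^sub>R w - (a / \<mu>) *\<^sub>R g w - ys))\<^sup>2"
  have sq: "N
      = (1 - a) * (Z \<bullet> Z) + a * (W \<bullet> W) - a * (1 - a) * ((Z - W) \<bullet> (Z - W))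
        - 2 * (a / \<mu>) * ((1 - a) * (Z \<bullet> G) + a * (W \<bullet> G)) + (a / \<mu>)\<^sup>2 * (G \<bullet> G)"
  proof -
    have "(1 - a) *\<^sub>R z + a *\<^sub>R w - (a / \<mu>) *\<^sub>R g w - ys
        = (1 - a) *\<^sub>R Z + a *\<^sub>R W - (a / \<mu>) *\<^sub>R G"
      by (simp add: Z_def W_def G_def algebra_simps)
    then show ?thesis unfolding N_def
      by (simp only: power2_norm_eq_inner inner_diff_left inner_diff_right inner_add_left
          inner_add_right inner_scaleR_left inner_scaleR_right inner_commute[of W Z]
          inner_commute[of G Z] inner_commute[of G W])
        (simp add: algebra_simps power2_eq_square add_divide_distrib diff_divide_distrib)
  qed
  have grad_term: "\<mu> / 2 * ((a / \<mu>)\<^sup>2 * (G \<bullet> G)) = (G \<bullet> G) / (2 * L)"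
    using mu L by (simp add: power_divide asq) (simp add: power2_eq_square field_simps)
  have "0 \<le> \<mu> / 2 * (a * (1 - a) * ((Z - W) \<bullet> (Z - W)))"
    using mu a0 by simp
  then have "\<mu> / 2 * N
      \<le> \<mu> / 2 * ((1 - a) * (Z \<bullet> Z) + a * (W \<bullet> W)) - a * ((1 - a) * (Z \<bullet> G) + a * (W \<bullet> G))
        + (G \<bullet> G) / (2 * L)"
    unfolding sq grad_term[symmetric] using mu by (simp add: algebra_simps)
  moreover have "a * (h w - W \<bullet> G + \<mu> / 2 * (W \<bullet> W)) \<le> a * h ys"
    using at_opt a0 by (intro mult_left_mono) auto
  moreover have "(1 - a) * (h w - a * (Z \<bullet> G - W \<bullet> G)) \<le> (1 - a) * h y"
    using at_y a0 by (intro mult_left_mono) auto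
  ultimately show ?thesis using descent
    unfolding N_def[symmetric] unfolding G_def[symmetric] Z_def[symmetric] power2_norm_eq_inner
    by (simp add: algebra_simps diff_divide_distrib)
qed

text \<open>
  The auxiliary point of the potential is \<open>w + \<surd>\<kappa> (w - y)\<close>, where \<open>y\<close> is the iterate and \<open>w\<close> the
  extrapolated one. The momentum parameter \<open>(\<surd>\<kappa> - 1) / (\<surd>\<kappa> + 1)\<close> is the one for which this point
  moves as the potential argument requires.
\<close>

lemma agd_linear_convergence:
  fixes h :: "'a::real_inner \<Rightarrow> real"
  assumes mu: "0 < \<mu>" "\<mu> \<le> L" and kappa: "\<kappa> = L / \<mu>"
    and upper: "\<And>z d. h (z + d) \<le> h z + d \<bullet> grad h z + L / 2 * (norm d)\<^sup>2"
    and lower: "\<And>z d. h z + d \<bullet> grad h z + \<mu> / 2 * (norm d)\<^sup>2 \<le> h (z + d)"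
    and opt: "grad h ys = 0"
  shows "(norm (agd h y0 K (1 / L) ((sqrt \<kappa> - 1) / (sqrt \<kappa> + 1)) - ys))\<^sup>2
           \<le> (\<kappa> + 1) * (1 - 1 / sqrt \<kappa>) ^ nat K * (norm (y0 - ys))\<^sup>2"
proof -
  define \<theta> where "\<theta> = (sqrt \<kappa> - 1) / (sqrt \<kappa> + 1)"
  define a where "a = sqrt (\<mu> / L)"
  have L: "0 < L" using mu by simp
  have a0: "0 < a" "a \<le> 1" and asq: "a * a = \<mu> / L" using mu L by (auto simp: a_def)
  have ak: "sqrt \<kappa> = 1 / a" using mu L by (simp add: a_def kappa real_sqrt_divide)
  have theta: "\<theta> * (1 + 1 / a) = 1 / a - 1"
  proof -
    have "\<theta> = (1 - a) / (1 + a)"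
      using a0 by (simp add: \<theta>_def ak diff_divide_eq_iff add_divide_eq_iff divide_add_eq_iff
          divide_diff_eq_iff)
    moreover have "1 + 1 / a = (1 + a) / a" "1 / a - 1 = (1 - a) / a"
      using a0 by (auto simp: field_simps)
    ultimately show ?thesis using a0 by simp
  qed
  define V where "V p = h (fst p) - h ys
      + \<mu> / 2 * (norm (snd p + (1 / a) *\<^sub>R (snd p - fst p) - ys))\<^sup>2" for p :: "'a \<times> 'a"
  have V: "V (agd_iter h y0 (1 / L) \<theta> k) \<le> (1 - a) ^ k * V (y0, y0)" for k
  proof (induction k)
    case (Suc k)
    obtain y w where yw: "agd_iter h y0 (1 / L) \<theta> k = (y, w)" by (cases "agd_iter h y0 (1 / L) \<theta> k")
    define z where "z = w + (1 / a) *\<^sub>R (w - y)"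
    define y' where "y' = w - (1 / L) *\<^sub>R grad h w"
    have wy: "y = w - a *\<^sub>R (z - w)" using a0 by (simp add: z_def)
    have "y' + \<theta> *\<^sub>R (y' - y) + (1 / a) *\<^sub>R (y' + \<theta> *\<^sub>R (y' - y) - y')
        = y' + (\<theta> * (1 + 1 / a)) *\<^sub>R (y' - y)"
      by (simp add: algebra_simps)
    also have "\<dots> = y' + (1 / a - 1) *\<^sub>R (a *\<^sub>R (z - w) - (1 / L) *\<^sub>R grad h w)"
      by (simp only: theta) (simp add: wy y'_def)
    also have "\<dots> = (1 - a) *\<^sub>R z + a *\<^sub>R w - (1 / (a * L)) *\<^sub>R grad h w"
    proof -
      have "(1 / a - 1) *\<^sub>R (a *\<^sub>R (z - w) - (1 / L) *\<^sub>R grad h w)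
          = ((1 / a - 1) * a) *\<^sub>R (z - w) - ((1 / a - 1) / L) *\<^sub>R grad h w"
        by (simp add: scaleR_diff_right)
      moreover have "(1 / a - 1) * a = 1 - a" using a0 by (simp add: field_simps)
      moreover have "1 / (a * L) = 1 / L + (1 / a - 1) / L"
        by (simp add: add_divide_distrib[symmetric])
      ultimately show ?thesis by (simp add: y'_def scaleR_add_left scaleR_diff_left scaleR_diff_right)
    qed
    also have "1 / (a * L) = a / \<mu>" using a0 mu L asq by (simp add: field_simps)
    finally have z': "y' + \<theta> *\<^sub>R (y' - y) + (1 / a) *\<^sub>R (y' + \<theta> *\<^sub>R (y' - y) - y')
        = (1 - a) *\<^sub>R z + a *\<^sub>R w - (a / \<mu>) *\<^sub>R grad h w" .
    have "agd_iter h y0 (1 / L) \<theta> (Suc k) = (y', y' + \<theta> *\<^sub>R (y' - y))"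
      by (simp add: yw y'_def Let_def)
    then have "V (agd_iter h y0 (1 / L) \<theta> (Suc k))
        = h y' - h ys + \<mu> / 2 * (norm ((1 - a) *\<^sub>R z + a *\<^sub>R w - (a / \<mu>) *\<^sub>R grad h w - ys))\<^sup>2"
      unfolding V_def by (simp only: fst_conv snd_conv z')
    also have "\<dots> \<le> (1 - a) * (h y - h ys + \<mu> / 2 * (norm (z - ys))\<^sup>2)"
      unfolding y'_def using mu a_def upper lower wy by (rule agd_potential_step)
    also have "\<dots> = (1 - a) * V (agd_iter h y0 (1 / L) \<theta> k)"
      by (simp add: V_def yw z_def)
    also have "\<dots> \<le> (1 - a) * ((1 - a) ^ k * V (y0, y0))"
      using a0 by (intro mult_left_mono Suc) simp
    finally show ?case by (simp add: mult.assoc)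
  qed simp
  have growth: "\<mu> / 2 * (norm (y - ys))\<^sup>2 \<le> h y - h ys" for y
    using lower[of ys "y - ys"] by (simp add: opt)
  have "V (y0, y0) \<le> (L + \<mu>) / 2 * (norm (y0 - ys))\<^sup>2"
    using upper[of ys "y0 - ys"] by (simp add: V_def opt field_simps)
  then have init: "(1 - a) ^ k * V (y0, y0) \<le> (1 - a) ^ k * ((L + \<mu>) / 2 * (norm (y0 - ys))\<^sup>2)" for k
    using a0 by (intro mult_left_mono) auto
  define yK where "yK = fst (agd_iter h y0 (1 / L) \<theta> (nat K))"
  have "\<mu> / 2 * (norm (yK - ys))\<^sup>2 \<le> V (agd_iter h y0 (1 / L) \<theta> (nat K))"
    using growth[of yK] mu by (simp add: V_def yK_def add_increasing2)
  also have "\<dots> \<le> (1 - a) ^ nat K * ((L + \<mu>) / 2 * (norm (y0 - ys))\<^sup>2)"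
    using V init by (rule order_trans)
  finally have "(norm (yK - ys))\<^sup>2 \<le> (L / \<mu> + 1) * (1 - a) ^ nat K * (norm (y0 - ys))\<^sup>2"
    using mu by (simp add: field_simps)
  then show ?thesis
    by (simp add: agd_def yK_def \<theta>_def kappa[symmetric] ak)
qed

text \<open>
  With \<open>r = \<surd>(\<kappa> + 1) D / \<delta>\<close>, the factor \<open>(1 - 1/\<surd>\<kappa>) ^ K\<close> is at most \<open>exp (- K / \<surd>\<kappa>) \<le> r\<^sup>-\<^sup>2\<close>. If
  \<open>K \<le> 0\<close> then \<open>r \<le> 1\<close> or \<open>D = 0\<close>, and the starting point is already good enough.
\<close>

lemma agd_accuracy:
  fixes h :: "'a::real_inner \<Rightarrow> real"
  assumes mu: "0 < \<mu>" "\<mu> \<le> L" and kappa: "\<kappa> = L / \<mu>"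
    and upper: "\<And>z d. h (z + d) \<le> h z + d \<bullet> grad h z + L / 2 * (norm d)\<^sup>2"
    and lower: "\<And>z d. h z + d \<bullet> grad h z + \<mu> / 2 * (norm d)\<^sup>2 \<le> h (z + d)"
    and opt: "grad h ys = 0"
    and D: "norm (y0 - ys) \<le> D" and \<delta>: "0 < \<delta>"
    and K: "K = \<lceil>2 * sqrt \<kappa> * ln (sqrt (\<kappa> + 1) / \<delta> * D)\<rceil>"
  shows "norm (agd h y0 K (1 / L) ((sqrt \<kappa> - 1) / (sqrt \<kappa> + 1)) - ys) \<le> \<delta>"
proof -
  define q where "q = 1 - 1 / sqrt \<kappa>"
  have k1: "1 \<le> \<kappa>" using mu by (simp add: kappa)
  then have sk: "1 \<le> sqrt \<kappa>" by simp
  then have q: "0 \<le> q" by (simp add: q_def)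
  have conv: "(norm (agd h y0 K (1 / L) ((sqrt \<kappa> - 1) / (sqrt \<kappa> + 1)) - ys))\<^sup>2
           \<le> (\<kappa> + 1) * q ^ nat K * (norm (y0 - ys))\<^sup>2"
    unfolding q_def by (rule agd_linear_convergence[OF mu kappa upper lower opt])
  have "(\<kappa> + 1) * q ^ nat K * (norm (y0 - ys))\<^sup>2 \<le> \<delta>\<^sup>2"
  proof (cases "D = 0")
    case True
    then show ?thesis using D by simp
  next
    case False
    then have D0: "0 < D" using D norm_ge_zero[of "y0 - ys"] by linarith
    define r where "r = sqrt (\<kappa> + 1) / \<delta> * D"
    have r: "0 < r" using D0 \<delta> k1 by (simp add: r_def)
    have "q ^ nat K \<le> exp (- (1 / sqrt \<kappa>)) ^ nat K"
      using exp_ge_add_one_self[of "- (1 / sqrt \<kappa>)"] q by (intro power_mono) (auto simp: q_def)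
    also have "\<dots> = exp (- (real (nat K) / sqrt \<kappa>))"
      by (simp add: exp_of_nat_mult[symmetric])
    also have "\<dots> \<le> exp (- (2 * ln r))"
    proof -
      have "2 * sqrt \<kappa> * ln r \<le> real_of_int K" by (simp add: K r_def)
      also have "\<dots> \<le> real (nat K)" by linarith
      finally show ?thesis using sk by (simp add: field_simps)
    qed
    also have "\<dots> = 1 / r\<^sup>2"
      using r by (simp add: exp_minus exp_double inverse_eq_divide)
    finally have "(\<kappa> + 1) * q ^ nat K * (norm (y0 - ys))\<^sup>2 \<le> (\<kappa> + 1) * (1 / r\<^sup>2) * D\<^sup>2"
      using D k1 q by (intro mult_mono power_mono) auto
    also have "\<dots> = \<delta>\<^sup>2"
    proof -
      have "r\<^sup>2 = (\<kappa> + 1) * (D\<^sup>2 / \<delta>\<^sup>2)"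
        using k1 by (simp add: r_def power_divide power_mult_distrib)
      then show ?thesis using D0 \<delta> k1 by simp
    qed
    finally show ?thesis .
  qed
  with conv have "(norm (agd h y0 K (1 / L) ((sqrt \<kappa> - 1) / (sqrt \<kappa> + 1)) - ys))\<^sup>2 \<le> \<delta>\<^sup>2"
    by (rule order_trans)
  then show ?thesis using \<delta> by (simp add: power2_le_iff_abs_le)
qed

section \<open>Quadratic forms and the smallest eigenvalue\<close>

text \<open>
  By polarisation, a symmetric operator is bounded by its quadratic form.
\<close>

lemma symmetric_bound_imp_norm_bound:
  fixes E :: "'a::real_inner \<Rightarrow> 'a"
  assumes lin: "linear E" and sym: "\<And>u v. u \<bullet> E v = v \<bullet> E u"
    and bound: "\<And>u. \<bar>u \<bullet> E u\<bar> \<le> c * (norm u)\<^sup>2"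
  shows "norm (E v) \<le> c * norm v"
proof (cases "v = 0 \<or> E v = 0")
  case True
  have "0 \<le> c * norm v"
  proof (cases "v = 0")
    case False
    have "0 \<le> c * (norm v)\<^sup>2" using bound[of v] by linarith
    then show ?thesis using False by (simp add: zero_le_mult_iff)
  qed simp
  then show ?thesis using True by (auto simp: linear_0[OF lin])
next
  case False
  define a b where "a = norm v" and "b = norm (E v)"
  have ab: "0 < a" "0 < b" using False by (auto simp: a_def b_def)
  define u w where "u = (1 / b) *\<^sub>R E v" and "w = (1 / a) *\<^sub>R v"
  have nu: "norm u = 1" and nw: "norm w = 1"
    using ab by (simp_all add: u_def w_def a_def b_def)
  have "4 * (u \<bullet> E w) = (u + w) \<bullet> E (u + w) - (u - w) \<bullet> E (u - w)"
    using sym[of u w]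
    by (simp add: linear_add[OF lin] linear_diff[OF lin] inner_add_left inner_add_right
        inner_diff_left inner_diff_right)
  also have "\<dots> \<le> c * (norm (u + w))\<^sup>2 + c * (norm (u - w))\<^sup>2"
    using bound[of "u + w"] bound[of "u - w"] by linarith
  also have "\<dots> = c * (2 * (norm u)\<^sup>2 + 2 * (norm w)\<^sup>2)"
    by (simp add: power2_norm_eq_inner inner_add_left inner_add_right
        inner_diff_left inner_diff_right inner_commute algebra_simps)
  finally have "u \<bullet> E w \<le> c" using nu nw by simp
  moreover have "u \<bullet> E w = b / a"
    using ab by (simp add: u_def w_def linear_cmul[OF lin] power2_norm_eq_inner[symmetric]
        b_def power2_eq_square)
  ultimately show ?thesis using ab by (simp add: a_def b_def field_simps)
qed

text \<open>
  Otherwise moving from \<open>v\<close> a little in direction \<open>- E v\<close> would make the form negative.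
\<close>

lemma nonneg_form_null_vector:
  fixes E :: "'a::real_inner \<Rightarrow> 'a"
  assumes lin: "linear E" and sym: "\<And>u v. u \<bullet> E v = v \<bullet> E u"
    and nonneg: "\<And>u. 0 \<le> u \<bullet> E u" and null: "v \<bullet> E v = 0"
  shows "E v = 0"
proof -
  have "2 * (E v \<bullet> E v) \<le> 0"
  proof (rule le_zero_if_le_scaled)
    fix t :: real assume "0 < t"
    have "0 \<le> (v - t *\<^sub>R E v) \<bullet> E (v - t *\<^sub>R E v)" by (rule nonneg)
    also have "\<dots> = t * (t * (E v \<bullet> E (E v)) - 2 * (E v \<bullet> E v))"
      using null sym[of v "E v"]
      by (simp add: linear_diff[OF lin] linear_cmul[OF lin] inner_diff_left inner_diff_right
          algebra_simps)
    finally show "2 * (E v \<bullet> E v) \<le> t * (E v \<bullet> E (E v))"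
      using \<open>0 < t\<close> by (simp add: zero_le_mult_iff)
  qed
  then have "E v \<bullet> E v = 0" using inner_ge_zero[of "E v"] by linarith
  then show ?thesis by simp
qed

text \<open>
  For a symmetric matrix the set of real eigenvalues in \<open>lambda_min\<close> has a minimum: it is finite,
  because eigenvectors to different eigenvalues are orthogonal, and nonempty, because a minimiser of
  the quadratic form on the unit sphere is an eigenvector. The bound then follows from a lowest
  eigenvector.
\<close>

lemma lambda_min_ge:
  fixes A :: "real^'n^'n"
  assumes sym: "\<And>u v. u \<bullet> (A *v v) = v \<bullet> (A *v u)"
    and bound: "\<And>u. c * (norm u)\<^sup>2 \<le> u \<bullet> (A *v u)"
  shows "c \<le> lambda_min A"
proof -
  define S where "S = {e. \<exists>v. v \<noteq> 0 \<and> A *v v = e *\<^sub>R v}"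
  have "finite S"
  proof -
    have "\<forall>e\<in>S. \<exists>v. v \<noteq> 0 \<and> A *v v = e *\<^sub>R v" by (simp add: S_def)
    then obtain ev where ev: "ev e \<noteq> 0 \<and> A *v ev e = e *\<^sub>R ev e" if "e \<in> S" for e
      by metis
    have orth: "ev e \<bullet> ev e' = 0" if "e \<in> S" "e' \<in> S" "e \<noteq> e'" for e e'
      using sym[of "ev e" "ev e'"] ev[OF that(1)] ev[OF that(2)] that(3)
      by (simp add: inner_commute)
    have inj: "inj_on ev S"
      by (rule inj_onI) (metis orth ev inner_eq_zero_iff)
    have "pairwise orthogonal (ev ` S)"
      by (auto simp: pairwise_def orthogonal_def intro!: orth)
    moreover have "0 \<notin> ev ` S" using ev by force
    ultimately have "finite (ev ` S)"
      using pairwise_orthogonal_independent independent_bound by blast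
    then show ?thesis using inj by (rule finite_imageD)
  qed
  moreover have "S \<noteq> {}"
  proof -
    have cont: "continuous_on (sphere 0 1) (\<lambda>u. u \<bullet> (A *v u))"
      by (intro continuous_intros matrix_vector_mult_linear_continuous_on)
    have "sphere (0::real^'n) 1 \<noteq> {}" by simp
    then obtain v where v: "norm v = 1"
      and vmin: "\<And>u. norm u = 1 \<Longrightarrow> v \<bullet> (A *v v) \<le> u \<bullet> (A *v u)"
      using continuous_attains_inf[OF compact_sphere _ cont] by (auto simp: dist_norm)
    define e where "e = v \<bullet> (A *v v)"
    define E where "E = (\<lambda>u. A *v u - e *\<^sub>R u)"
    have "E v = 0"
    proof (rule nonneg_form_null_vector[where E = E])
      show "linear E"
        unfolding E_def by (intro linear_compose_sub matrix_vector_mul_linear linear_scaleR)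
      show "u \<bullet> E w = w \<bullet> E u" for u w
        using sym[of u w] by (simp add: E_def inner_diff_right inner_commute)
      show "v \<bullet> E v = 0"
        using v by (simp add: E_def e_def inner_diff_right power2_norm_eq_inner[symmetric])
      show "0 \<le> u \<bullet> E u" for u
      proof (cases "u = 0")
        case False
        have "e \<le> ((1 / norm u) *\<^sub>R u) \<bullet> (A *v ((1 / norm u) *\<^sub>R u))"
          unfolding e_def by (rule vmin) (simp add: False)
        also have "\<dots> = (u \<bullet> (A *v u)) / (norm u)\<^sup>2"
          by (simp add: matrix_vector_mult_scaleR power2_eq_square)
        finally have "e * (norm u)\<^sup>2 \<le> u \<bullet> (A *v u)" using False by (simp add: field_simps)
        then show ?thesis by (simp add: E_def inner_diff_right power2_norm_eq_inner)
      qed (simp add: E_def)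
    qed
    then have "A *v v = e *\<^sub>R v" by (simp add: E_def)
    moreover have "v \<noteq> 0" using v by auto
    ultimately show ?thesis unfolding S_def by blast
  qed
  ultimately have "lambda_min A \<in> S"
    unfolding lambda_min_def S_def[symmetric] by (rule Min_in)
  then obtain v where v: "v \<noteq> 0" "A *v v = lambda_min A *\<^sub>R v" by (auto simp: S_def)
  have "c * (norm v)\<^sup>2 \<le> lambda_min A * (norm v)\<^sup>2"
    using bound[of v] v(2) by (simp add: power2_norm_eq_inner)
  then show ?thesis using v(1) by simp
qed

section \<open>Global minimisers of the cubic model\<close>

text \<open>
  This exact expansion replaces differentiation of the cubed norm. It groups the terms so that the last
  one is of order \<open>|d|\<^sup>2\<close> and vanishes when \<open>s + d\<close> has the same norm as \<open>s\<close>; the first fact is used for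
  the first-order condition, the second one for the second-order condition.
\<close>

lemma cubic_model_expansion:
  fixes H :: "real^'n^'n"
  assumes sym: "\<And>u v. u \<bullet> (H *v v) = v \<bullet> (H *v u)"
  shows "cubic_model g H M (s + d) - cubic_model g H M s
           = d \<bullet> (g + H *v s + (M / 2 * norm s) *\<^sub>R s)
             + 1/2 * (d \<bullet> (H *v d) + M / 2 * norm s * (norm d)\<^sup>2)
             + M / 6 * (norm (s + d) - norm s)\<^sup>2 * (norm (s + d) + norm s / 2)"
proof -
  define q r where "q = norm (s + d)" and "r = norm s"
  have cube: "q ^ 3 - r ^ 3 = 3 / 2 * r * (q\<^sup>2 - r\<^sup>2) + (q - r)\<^sup>2 * (q + r / 2)"
    by (simp add: power2_eq_square power3_eq_cube field_simps)
  have "q\<^sup>2 - r\<^sup>2 = 2 * (d \<bullet> s) + (norm d)\<^sup>2"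
    by (simp add: q_def r_def power2_norm_eq_inner inner_add_left inner_add_right inner_commute)
  note cube = cube[unfolded this]
  have "cubic_model g H M (s + d) - cubic_model g H M s
      = d \<bullet> g + d \<bullet> (H *v s) + 1/2 * (d \<bullet> (H *v d)) + M / 6 * (q ^ 3 - r ^ 3)"
    using sym[of s d]
    by (simp add: cubic_model_def q_def r_def matrix_vector_right_distrib inner_add_left
        inner_add_right inner_commute algebra_simps)
  then show ?thesis unfolding cube
    by (simp add: q_def r_def inner_add_right algebra_simps)
qed

lemma cubic_model_stationary:
  fixes H :: "real^'n^'n"
  assumes sym: "\<And>u v. u \<bullet> (H *v v) = v \<bullet> (H *v u)" and M: "0 \<le> M"
    and min: "\<And>s'. cubic_model g H M s \<le> cubic_model g H M s'"
  shows "g + H *v s + (M / 2 * norm s) *\<^sub>R s = 0"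
proof -
  define G where "G = g + H *v s + (M / 2 * norm s) *\<^sub>R s"
  have le: "- (u \<bullet> G) \<le> 0" for u
  proof (rule le_zero_if_le_scaled)
    fix t :: real assume t: "0 < t" "t \<le> 1"
    define q where "q = norm (s + t *\<^sub>R u)"
    have "\<bar>q - norm s\<bar> \<le> t * norm u"
      using norm_triangle_ineq3[of "s + t *\<^sub>R u" s] t by (simp add: q_def)
    then have q1: "(q - norm s)\<^sup>2 \<le> (t * norm u)\<^sup>2" using abs_le_square_iff by fastforce
    have "t * norm u \<le> norm u" using t by (simp add: mult_left_le_one_le)
    then have q2: "q \<le> norm s + norm u"
      using norm_triangle_ineq[of s "t *\<^sub>R u"] t by (simp add: q_def)
    have "(q - norm s)\<^sup>2 * (q + norm s / 2) \<le> (t * norm u)\<^sup>2 * (norm s + norm u + norm s / 2)"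
      using q1 q2 by (intro mult_mono) (auto simp: q_def)
    then have "M / 6 * ((q - norm s)\<^sup>2 * (q + norm s / 2))
        \<le> M / 6 * ((t * norm u)\<^sup>2 * (norm s + norm u + norm s / 2))"
      using M by (intro mult_left_mono) auto
    moreover have "0 \<le> t * (u \<bullet> G)
        + 1/2 * (t\<^sup>2 * (u \<bullet> (H *v u)) + M / 2 * norm s * (t * norm u)\<^sup>2)
        + M / 6 * ((q - norm s)\<^sup>2 * (q + norm s / 2))"
      using min[of "s + t *\<^sub>R u"] cubic_model_expansion[OF sym, of g M s "t *\<^sub>R u"] t
      by (simp add: G_def q_def matrix_vector_mult_scaleR power2_eq_square mult.assoc)
    ultimately have "0 \<le> t * (u \<bullet> G + t * (1/2 * (u \<bullet> (H *v u) + M / 2 * norm s * (norm u)\<^sup>2)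
        + M / 6 * ((norm u)\<^sup>2 * (norm s + norm u + norm s / 2))))"
      by (simp add: power_mult_distrib power2_eq_square algebra_simps)
    then show "- (u \<bullet> G) \<le> t * (1/2 * (u \<bullet> (H *v u) + M / 2 * norm s * (norm u)\<^sup>2)
        + M / 6 * ((norm u)\<^sup>2 * (norm s + norm u + norm s / 2)))"
      using t by (simp add: zero_le_mult_iff)
  qed
  have "G \<bullet> G \<le> 0" using le[of "- G"] by simp
  then have "G = 0" using inner_ge_zero[of G] inner_eq_zero_iff[of G] by linarith
  then show ?thesis by (simp add: G_def)
qed

text \<open>
  If \<open>u\<close> is not
  orthogonal to \<open>s\<close>, the line through \<open>s\<close> in direction \<open>u\<close> meets the sphere of radius \<open>|s|\<close> in a
  second point, and the model values of the two points differ exactly by a multiple of the form at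
  \<open>u\<close>. The remaining directions are limits of such \<open>u\<close>, unless \<open>s = 0\<close>, where the
  expansion along \<open>u\<close> itself suffices.
\<close>

lemma cubic_model_curvature:
  fixes H :: "real^'n^'n"
  assumes sym: "\<And>u v. u \<bullet> (H *v v) = v \<bullet> (H *v u)" and M: "0 \<le> M"
    and min: "\<And>s'. cubic_model g H M s \<le> cubic_model g H M s'"
  shows "0 \<le> u \<bullet> (H *v u) + M / 2 * norm s * (norm u)\<^sup>2"
proof -
  define B where "B u = u \<bullet> (H *v u) + M / 2 * norm s * (norm u)\<^sup>2" for u
  have expand: "0 \<le> 1/2 * B d + M / 6 * (norm (s + d) - norm s)\<^sup>2 * (norm (s + d) + norm s / 2)" for d
    using min[of "s + d"] cubic_model_expansion[OF sym, of g M s d]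
      cubic_model_stationary[OF sym M min] by (simp add: B_def)
  have scale: "B (t *\<^sub>R u) = t\<^sup>2 * B u" for t u
    by (simp add: B_def matrix_vector_mult_scaleR power_mult_distrib power2_eq_square algebra_simps)
  have non_orth: "0 \<le> B u" if "s \<bullet> u \<noteq> 0" for u
  proof -
    have u: "u \<bullet> u \<noteq> 0" using that by auto
    define t where "t = - 2 * (s \<bullet> u) / (u \<bullet> u)"
    have "(s + t *\<^sub>R u) \<bullet> (s + t *\<^sub>R u) = s \<bullet> s + t * (2 * (s \<bullet> u) + t * (u \<bullet> u))"
      by (simp add: inner_add_left inner_add_right inner_commute algebra_simps)
    also have "2 * (s \<bullet> u) + t * (u \<bullet> u) = 0" using u by (simp add: t_def)
    finally have "norm (s + t *\<^sub>R u) = norm s" by (simp add: norm_eq_sqrt_inner)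
    then have "0 \<le> t\<^sup>2 * B u" using expand[of "t *\<^sub>R u"] by (simp add: scale)
    moreover have "t \<noteq> 0" using that u by (simp add: t_def)
    ultimately show ?thesis by (simp add: zero_le_mult_iff)
  qed
  have "- B u \<le> 0"
  proof (cases "s = 0")
    case True
    show ?thesis
    proof (rule le_zero_if_le_scaled)
      fix t :: real assume t: "0 < t" "t \<le> 1"
      have "0 \<le> t\<^sup>2 * (B u + t * (M / 3 * norm u ^ 3))"
        using expand[of "t *\<^sub>R u"] True t unfolding scale
        by (simp add: power_mult_distrib power2_eq_square power3_eq_cube algebra_simps)
      then show "- B u \<le> t * (M / 3 * norm u ^ 3)"
        using t by (simp add: zero_le_mult_iff)
    qed
  next
    case s: False
    show ?thesis
    proof (cases "s \<bullet> u = 0")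
      case True
      show ?thesis
      proof (rule le_zero_if_le_scaled)
        fix t :: real assume t: "0 < t" "t \<le> 1"
        have "0 \<le> B (u + t *\<^sub>R s)"
          using True s t by (intro non_orth) (simp add: inner_add_right)
        also have "\<dots> = B u + t * (2 * (s \<bullet> (H *v u)) + t * B s)"
          using True sym[of s u]
          by (simp add: B_def power2_norm_eq_inner inner_add_left inner_add_right inner_commute
              matrix_vector_mult_scaleR matrix_vector_right_distrib algebra_simps)
        also have "\<dots> \<le> B u + t * (2 * (s \<bullet> (H *v u)) + \<bar>B s\<bar>)"
        proof -
          have "t * B s \<le> t * \<bar>B s\<bar>" using t by (intro mult_left_mono) auto
          also have "\<dots> \<le> \<bar>B s\<bar>" using t by (simp add: mult_left_le_one_le)
          finally show ?thesis using t by simp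
        qed
        finally show "- B u \<le> t * (2 * (s \<bullet> (H *v u)) + \<bar>B s\<bar>)" by simp
      qed
    qed (use non_orth in simp)
  qed
  then show ?thesis by (simp add: B_def)
qed

section \<open>Smooth functions that are strongly concave in the second argument\<close>

lemma matrix_of_real_linear: "linear f \<Longrightarrow> matrix f *v u = f u"
  for f :: "real^'a \<Rightarrow> real^'b"
  by (rule matrix_works) (simp add: linear_matrix_vector_mul_eq)

lemma norm_components_le: "norm (fst z) \<le> norm z" "norm (snd z) \<le> norm z"
  by (cases z; simp add: norm_fst_le norm_snd_le)+

text \<open>
  The constant \<open>M\<close> is twice the Lipschitz constant \<open>2 \<surd>2 \<kappa>\<^sup>3 \<rho>\<close> of the Schur complement along the
  curve of maximisers; the factor two is the slack that absorbs the inexactness of the steps.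
\<close>

locale smooth_strongly_concave =
  fixes f :: "(real^'n) \<times> (real^'m) \<Rightarrow> real" and L \<rho> \<mu> \<kappa> M :: real
  assumes pos: "L > 0" "\<rho> > 0" "\<mu> > 0"
    and diff: "twice_differentiable f"
    and lipschitz_gradient: "\<And>x x' y y'. (norm (grad f (x, y) - grad f (x', y')))\<^sup>2
               \<le> L\<^sup>2 * ((norm (x - x'))\<^sup>2 + (norm (y - y'))\<^sup>2)"
    and lipschitz_hessian: "\<And>x x' y y'. (onorm (\<lambda>w. hess f (x, y) w - hess f (x', y') w))\<^sup>2
               \<le> \<rho>\<^sup>2 * ((norm (x - x'))\<^sup>2 + (norm (y - y'))\<^sup>2)"
    and strongly_concave: "\<And>x y y'. f (x, y) \<le> f (x, y') + grad_y f x y' \<bullet> (y - y')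
               - \<mu> / 2 * (norm (y - y'))\<^sup>2"
    and kappa: "\<kappa> = L / \<mu>"
    and M: "M = 4 * sqrt 2 * \<kappa> ^ 3 * \<rho>"
begin

lemma has_derivative_f: "(f has_derivative (\<lambda>d. d \<bullet> grad f z)) (at z)"
  using diff unfolding twice_differentiable_def by (intro has_derivative_grad) blast

lemma has_derivative_grad_f: "(grad f has_derivative hess f z) (at z)"
  using diff unfolding twice_differentiable_def hess_def frechet_derivative_works[symmetric]
  by blast

lemma linear_hess: "linear (hess f z)"
  by (rule has_derivative_linear[OF has_derivative_grad_f])

lemma grad_lipschitz: "norm (grad f z - grad f z') \<le> L * norm (z - z')"
proof -
  have "(norm (grad f z - grad f z'))\<^sup>2 \<le> (L * norm (z - z'))\<^sup>2"
    using lipschitz_gradient[of "fst z" "snd z" "fst z'" "snd z'"]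
    by (simp add: power_mult_distrib norm_prod_def)
  then show ?thesis using pos by (simp add: power2_le_iff_abs_le)
qed

lemma hess_lipschitz: "norm (hess f z w - hess f z' w) \<le> \<rho> * norm (z - z') * norm w"
proof -
  let ?E = "\<lambda>w. hess f z w - hess f z' w"
  have bl: "bounded_linear ?E"
    by (intro bounded_linear_sub has_derivative_bounded_linear[OF has_derivative_grad_f])
  have "(onorm ?E)\<^sup>2 \<le> (\<rho> * norm (z - z'))\<^sup>2"
    using lipschitz_hessian[of "fst z" "snd z" "fst z'" "snd z'"]
    by (simp add: power_mult_distrib norm_prod_def)
  then have "onorm ?E \<le> \<rho> * norm (z - z')" using pos by (simp add: power2_le_iff_abs_le)
  then show ?thesis
    by (intro order_trans[OF onorm[OF bl]] mult_right_mono) auto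
qed

lemma grad_taylor: "norm (grad f (z + d) - grad f z - hess f z d) \<le> \<rho> / 2 * (norm d)\<^sup>2"
  by (rule gradient_taylor_bound[OF has_derivative_grad_f hess_lipschitz])

lemma taylor_upper: "f (z + d) \<le> f z + d \<bullet> grad f z + 1/2 * (d \<bullet> hess f z d) + \<rho> / 6 * norm d ^ 3"
  by (rule value_taylor_upper[OF has_derivative_f has_derivative_grad_f hess_lipschitz])

lemma taylor_lower: "f z + d \<bullet> grad f z + 1/2 * (d \<bullet> hess f z d) - \<rho> / 6 * norm d ^ 3 \<le> f (z + d)"
  using value_taylor_upper[where f = "\<lambda>z. - f z" and g = "\<lambda>z. - grad f z" and z = z and d = d
      and H = "\<lambda>z w. - hess f z w" and \<rho> = \<rho>]
    has_derivative_minus[OF has_derivative_f] has_derivative_minus[OF has_derivative_grad_f]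
    hess_lipschitz
  by (simp add: norm_minus_commute minus_diff_commute)

lemma hess_symmetric: "a \<bullet> hess f z b = b \<bullet> hess f z a"
  using pos
  by (intro hessian_symmetric[OF has_derivative_f has_derivative_grad_f hess_lipschitz]) simp

text \<open>
  The derivative of an \<open>L\<close>-Lipschitz map has norm at most \<open>L\<close>.
\<close>

lemma norm_hess_le: "norm (hess f z w) \<le> L * norm w"
proof -
  have "norm (hess f z w) - L * norm w \<le> 0"
  proof (rule le_zero_if_le_scaled)
    fix t :: real assume t: "0 < t"
    have "norm (hess f z (t *\<^sub>R w)) \<le> norm (grad f (z + t *\<^sub>R w) - grad f z) + \<rho> / 2 * (norm (t *\<^sub>R w))\<^sup>2"
      using grad_taylor[of z "t *\<^sub>R w"]
        norm_triangle_ineq2[of "hess f z (t *\<^sub>R w)" "grad f (z + t *\<^sub>R w) - grad f z"]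
      by (simp add: norm_minus_commute)
    also have "\<dots> \<le> L * norm (t *\<^sub>R w) + \<rho> / 2 * (norm (t *\<^sub>R w))\<^sup>2"
      using grad_lipschitz[of "z + t *\<^sub>R w" z] by simp
    finally have "t * (norm (hess f z w) - L * norm w) \<le> t * (t * (\<rho> / 2 * (norm w)\<^sup>2))"
      using t by (simp add: linear_cmul[OF linear_hess] power_mult_distrib power2_eq_square algebra_simps)
    then show "norm (hess f z w) - L * norm w \<le> t * (\<rho> / 2 * (norm w)\<^sup>2)" using t by simp
  qed
  then show ?thesis by simp
qed

lemma grad_x_eq: "grad_x f x y = fst (grad f (x, y))"
  unfolding grad_x_def
proof (rule grad_eqI)
  have "((\<lambda>x'. (x', y)) has_derivative (\<lambda>h. (h, 0))) (at x)"
    by (auto intro!: derivative_eq_intros)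
  from has_derivative_compose[OF this has_derivative_f]
  show "((\<lambda>x'. f (x', y)) has_derivative (\<lambda>h. h \<bullet> fst (grad f (x, y)))) (at x)"
    by (simp add: inner_prod_def)
qed

lemma has_derivative_f_y:
  "((\<lambda>y'. f (x, y')) has_derivative (\<lambda>h. h \<bullet> snd (grad f (x, y)))) (at y)"
proof -
  have "((\<lambda>y'. (x, y')) has_derivative (\<lambda>h. (0, h))) (at y)"
    by (auto intro!: derivative_eq_intros)
  from has_derivative_compose[OF this has_derivative_f] show ?thesis
    by (simp add: inner_prod_def)
qed

lemma grad_y_eq: "grad_y f x y = snd (grad f (x, y))"
  unfolding grad_y_def by (rule grad_eqI) (rule has_derivative_f_y)

text \<open>
  Compare strong concavity with the lower Taylor bound in direction \<open>(0, v)\<close> and let the step tend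
  to zero.
\<close>

lemma hess_yy_le: "(0, v) \<bullet> hess f z (0, v) \<le> - (\<mu> * (norm v)\<^sup>2)"
proof -
  obtain x y where z: "z = (x, y)" by (cases z)
  have "(0, v) \<bullet> hess f z (0, v) + \<mu> * (norm v)\<^sup>2 \<le> 0"
  proof (rule le_zero_if_le_scaled)
    fix t :: real assume t: "0 < t"
    have e: "(0, t *\<^sub>R v) = t *\<^sub>R (0::real^'n, v)" by simp
    have nv: "norm (0::real^'n, v) = norm v" by (simp add: norm_Pair)
    have "f (z + (0, t *\<^sub>R v)) \<le> f z + (0, t *\<^sub>R v) \<bullet> grad f z - \<mu> / 2 * (norm (t *\<^sub>R v))\<^sup>2"
      using strongly_concave[of x "y + t *\<^sub>R v" y]
      by (simp add: z grad_y_eq inner_prod_def inner_commute)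
    with taylor_lower[of z "(0, t *\<^sub>R v)"]
    have "1/2 * ((0, t *\<^sub>R v) \<bullet> hess f z (0, t *\<^sub>R v)) + \<mu> / 2 * (norm (t *\<^sub>R v))\<^sup>2
        \<le> \<rho> / 6 * norm (0::real^'n, t *\<^sub>R v) ^ 3"
      by linarith
    then have "t\<^sup>2 * ((0, v) \<bullet> hess f z (0, v) + \<mu> * (norm v)\<^sup>2) \<le> t\<^sup>2 * (t * (\<rho> / 3 * norm v ^ 3))"
      unfolding e linear_cmul[OF linear_hess] inner_scaleR_left inner_scaleR_right norm_scaleR nv
      using t by (simp add: power_mult_distrib power2_eq_square power3_eq_cube algebra_simps)
    then show "(0, v) \<bullet> hess f z (0, v) + \<mu> * (norm v)\<^sup>2 \<le> t * (\<rho> / 3 * norm v ^ 3)"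
      using t by simp
  qed
  then show ?thesis by simp
qed

lemma mu_le_L: "\<mu> \<le> L"
proof -
  define v where "v = (axis undefined 1 :: real^'m)"
  have v: "norm v = 1" by (simp add: v_def)
  have "\<mu> * (norm v)\<^sup>2 \<le> - ((0::real^'n, v) \<bullet> hess f 0 (0, v))" using hess_yy_le[of v 0] by simp
  also have "\<dots> \<le> norm (0::real^'n, v) * norm (hess f 0 (0, v))"
    using Cauchy_Schwarz_ineq2[of "(0::real^'n, v)" "hess f 0 (0, v)"] by linarith
  also have "\<dots> \<le> L"
    using norm_hess_le[of 0 "(0, v)"] v by (simp add: norm_Pair)
  finally show ?thesis using v by simp
qed

lemma kappa_ge_1: "1 \<le> \<kappa>" and L_eq: "L = \<kappa> * \<mu>"
  using mu_le_L pos by (simp_all add: kappa)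

lemma M_pos: "0 < M" using pos kappa_ge_1 by (simp add: M)

lemma sqrt_one_plus_kappa_le: "sqrt (1 + \<kappa>\<^sup>2) \<le> sqrt 2 * \<kappa>"
proof -
  have "1 + \<kappa>\<^sup>2 \<le> 2 * \<kappa>\<^sup>2" using kappa_ge_1 by simp
  then have "sqrt (1 + \<kappa>\<^sup>2) \<le> sqrt (2 * \<kappa>\<^sup>2)" by simp
  then show ?thesis using kappa_ge_1 by (simp add: real_sqrt_mult)
qed

lemma norm_Pair_le_kappa:
  assumes "norm v \<le> \<kappa> * norm u"
  shows "norm (u, v) \<le> sqrt 2 * \<kappa> * norm u"
proof -
  have "(norm u)\<^sup>2 + (norm v)\<^sup>2 \<le> (norm u)\<^sup>2 + (\<kappa> * norm u)\<^sup>2"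
    using assms by (intro add_left_mono power_mono) auto
  also have "\<dots> = (1 + \<kappa>\<^sup>2) * (norm u)\<^sup>2" by (simp add: power_mult_distrib algebra_simps)
  finally have "norm (u, v) \<le> sqrt ((1 + \<kappa>\<^sup>2) * (norm u)\<^sup>2)"
    by (simp only: norm_Pair real_sqrt_le_mono)
  also have "\<dots> = sqrt (1 + \<kappa>\<^sup>2) * norm u" by (simp add: real_sqrt_mult)
  also have "\<dots> \<le> sqrt 2 * \<kappa> * norm u"
    using sqrt_one_plus_kappa_le by (intro mult_right_mono) auto
  finally show ?thesis .
qed

section \<open>The Schur complement of the Hessian\<close>

lemma
  shows hess_xx_mult: "hess_xx f x y *v u = fst (hess f (x, y) (u, 0))"
    and hess_xy_mult: "hess_xy f x y *v v = fst (hess f (x, y) (0, v))"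
    and hess_yx_mult: "hess_yx f x y *v u = snd (hess f (x, y) (u, 0))"
    and hess_yy_mult: "hess_yy f x y *v v = snd (hess f (x, y) (0, v))"
proof -
  have lin: "linear (\<lambda>u. (u, 0::real^'m))" "linear (\<lambda>v. (0::real^'n, v))"
    by (auto intro!: linearI)
  note comp = linear_compose[OF linear_compose[OF _ linear_hess], unfolded o_def]
  show "hess_xx f x y *v u = fst (hess f (x, y) (u, 0))"
    unfolding hess_xx_def by (rule matrix_of_real_linear, rule comp[OF lin(1) linear_fst])
  show "hess_xy f x y *v v = fst (hess f (x, y) (0, v))"
    unfolding hess_xy_def by (rule matrix_of_real_linear, rule comp[OF lin(2) linear_fst])
  show "hess_yx f x y *v u = snd (hess f (x, y) (u, 0))"
    unfolding hess_yx_def by (rule matrix_of_real_linear, rule comp[OF lin(1) linear_snd])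
  show "hess_yy f x y *v v = snd (hess f (x, y) (0, v))"
    unfolding hess_yy_def by (rule matrix_of_real_linear, rule comp[OF lin(2) linear_snd])
qed

lemma hess_Pair: "hess f z (u, v) = hess f z (u, 0) + hess f z (0, v)"
  using linear_add[OF linear_hess, of z "(u, 0)" "(0, v)"] by simp

text \<open>
  The vector \<open>v = - D\<^sup>-\<^sup>1 C u\<close> (with \<open>D\<close> the \<open>yy\<close> and \<open>C\<close> the \<open>yx\<close> block) annihilates the second component.
  Its norm is bounded by \<open>\<kappa> |u|\<close> since \<open>- D \<ge> \<mu>\<close> and \<open>|C| \<le> L\<close>. Every property of the Schur complement is
  derived from this lift instead of from the inverse matrix.
\<close>

lemma hess_lift:
  obtains v where "hess f (x, y) (u, v) = (minimax_hess f x y *v u, 0)" and "norm v \<le> \<kappa> * norm u"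
proof -
  let ?D = "hess_yy f x y" and ?C = "hess_yx f x y"
  have "invertible ?D"
    unfolding invertible_left_inverse matrix_left_invertible_ker
  proof (intro allI impI)
    fix v assume "?D *v v = 0"
    then have "(0, v) \<bullet> hess f (x, y) (0, v) = 0" by (simp add: hess_yy_mult inner_prod_def)
    with hess_yy_le[of v "(x, y)"] have "\<mu> * (norm v)\<^sup>2 \<le> 0" by simp
    then show "v = 0" using pos by (simp add: mult_le_0_iff)
  qed
  then have inv: "?D ** matrix_inv ?D = mat 1"
    unfolding invertible_def matrix_inv_def by (metis (mono_tags, lifting) someI_ex)
  define v where "v = - (matrix_inv ?D *v (?C *v u))"
  have "?D *v v = - ((?D ** matrix_inv ?D) *v (?C *v u))"
    by (simp add: v_def matrix_vector_mul_assoc matrix_mul_assoc linear_neg[OF matrix_vector_mul_linear])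
  then have Dv: "?D *v v = - (?C *v u)" by (simp add: inv)
  have "minimax_hess f x y *v u = hess_xx f x y *v u + hess_xy f x y *v v"
    by (simp add: minimax_hess_def v_def matrix_vector_mult_diff_rdistrib
        matrix_vector_mul_assoc[symmetric] linear_neg[OF matrix_vector_mul_linear])
  then have "hess f (x, y) (u, v) = (minimax_hess f x y *v u, 0)"
    using Dv by (simp add: hess_Pair[of _ u v] prod_eq_iff hess_xx_mult hess_xy_mult
        hess_yx_mult hess_yy_mult)
  moreover have "norm v \<le> \<kappa> * norm u"
  proof (cases "v = 0")
    case True
    then show ?thesis using kappa_ge_1 by simp
  next
    case False
    have "\<mu> * (norm v)\<^sup>2 \<le> - (v \<bullet> (?D *v v))"
      using hess_yy_le[of v "(x, y)"] by (simp add: hess_yy_mult inner_prod_def)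
    also have "\<dots> = v \<bullet> (?C *v u)" by (simp add: Dv)
    also have "\<dots> \<le> norm v * norm (?C *v u)" by (rule norm_cauchy_schwarz)
    also have "\<dots> \<le> norm v * (L * norm u)"
    proof (rule mult_left_mono)
      have "norm (?C *v u) \<le> norm (hess f (x, y) (u, 0))"
        unfolding hess_yx_mult by (rule norm_components_le)
      also have "\<dots> \<le> L * norm (u, 0::real^'m)" by (rule norm_hess_le)
      finally show "norm (?C *v u) \<le> L * norm u" by (simp add: norm_Pair)
    qed simp
    finally have "norm v * (\<mu> * norm v) \<le> norm v * (\<mu> * (\<kappa> * norm u))"
      by (simp add: L_eq power2_eq_square algebra_simps)
    then show ?thesis using False pos by simp
  qed
  ultimately show thesis by (rule that)
qed

text \<open>
  With the lift \<open>v\<close> of \<open>u\<close>, write \<open>(u, w) = (u, v) + (0, w - v)\<close>. The mixed term vanishes and the pure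
  \<open>y\<close> term is not positive, so the Schur form is the maximum of the full form over \<open>w\<close>.
\<close>

lemma hess_quadratic_le_minimax_hess:
  "(u, w) \<bullet> hess f (x, y) (u, w) \<le> u \<bullet> (minimax_hess f x y *v u)"
proof -
  obtain v where v: "hess f (x, y) (u, v) = (minimax_hess f x y *v u, 0)"
    using hess_lift by blast
  have e: "(u, w) = (u, v) + (0, w - v)" by simp
  have "(u, w) \<bullet> hess f (x, y) (u, w)
      = (u, v) \<bullet> hess f (x, y) (u, v) + 2 * ((0, w - v) \<bullet> hess f (x, y) (u, v))
        + (0, w - v) \<bullet> hess f (x, y) (0, w - v)"
    unfolding e linear_add[OF linear_hess] inner_add_left inner_add_right
    by (simp only: hess_symmetric[of "(u, v)" "(x, y)" "(0, w - v)"])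
  also have "\<dots> \<le> u \<bullet> (minimax_hess f x y *v u)"
  proof -
    have "0 \<le> \<mu> * (norm (w - v))\<^sup>2" using pos by simp
    with hess_yy_le[of "w - v" "(x, y)"] show ?thesis by (simp add: v inner_prod_def)
  qed
  finally show ?thesis .
qed

lemma minimax_hess_symmetric: "u \<bullet> (minimax_hess f x y *v w) = w \<bullet> (minimax_hess f x y *v u)"
proof -
  obtain v v' where
    "hess f (x, y) (u, v) = (minimax_hess f x y *v u, 0)"
    "hess f (x, y) (w, v') = (minimax_hess f x y *v w, 0)"
    using hess_lift by metis
  then show ?thesis
    using hess_symmetric[of "(u, v)" "(x, y)" "(w, v')"] by simp
qed

lemma minimax_hess_quadratic_le: "\<bar>u \<bullet> (minimax_hess f x y *v u)\<bar> \<le> 3 / 2 * \<kappa> * L * (norm u)\<^sup>2"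
proof -
  obtain v where v: "hess f (x, y) (u, v) = (minimax_hess f x y *v u, 0)" "norm v \<le> \<kappa> * norm u"
    using hess_lift by blast
  have "norm (minimax_hess f x y *v u) = norm (hess f (x, y) (u, v))" by (simp add: v norm_Pair)
  also have "\<dots> \<le> L * norm (u, v)" by (rule norm_hess_le)
  also have "\<dots> \<le> L * (sqrt 2 * \<kappa> * norm u)"
    using pos by (intro mult_left_mono norm_Pair_le_kappa v) auto
  also have "\<dots> \<le> L * (3 / 2 * \<kappa> * norm u)"
  proof -
    have "sqrt 2 \<le> 3 / 2" by (rule real_le_lsqrt) (simp_all add: power2_eq_square)
    then show ?thesis using pos kappa_ge_1 by (intro mult_left_mono mult_right_mono) auto
  qed
  finally have "norm u * norm (minimax_hess f x y *v u) \<le> norm u * (L * (3 / 2 * \<kappa> * norm u))"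
    by (rule mult_left_mono) simp
  then show ?thesis
    using Cauchy_Schwarz_ineq2[of u "minimax_hess f x y *v u"]
    by (simp add: power2_eq_square algebra_simps)
qed

text \<open>
  A maximum of forms is as Lipschitz as the forms, evaluated at the maximiser: with the lift of
  \<open>u\<close> at the first point, \<open>|(u, v)|\<^sup>2 \<le> 2 \<kappa>\<^sup>2 |u|\<^sup>2\<close>.
\<close>

lemma minimax_hess_lipschitz_one_sided:
  "u \<bullet> (minimax_hess f x y *v u)
     \<le> u \<bullet> (minimax_hess f x' y' *v u) + 2 * \<kappa>\<^sup>2 * \<rho> * norm ((x, y) - (x', y')) * (norm u)\<^sup>2"
proof -
  let ?z = "(x, y)" and ?z' = "(x', y')"
  obtain v where v: "hess f ?z (u, v) = (minimax_hess f x y *v u, 0)" "norm v \<le> \<kappa> * norm u"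
    using hess_lift by blast
  have "(u, v) \<bullet> (hess f ?z (u, v) - hess f ?z' (u, v))
      \<le> norm (u, v) * norm (hess f ?z (u, v) - hess f ?z' (u, v))"
    by (rule norm_cauchy_schwarz)
  also have "\<dots> \<le> norm (u, v) * (\<rho> * norm (?z - ?z') * norm (u, v))"
    by (intro mult_left_mono hess_lipschitz) simp
  also have "\<dots> = \<rho> * norm (?z - ?z') * (norm (u, v))\<^sup>2" by (simp add: power2_eq_square)
  also have "\<dots> \<le> \<rho> * norm (?z - ?z') * (sqrt 2 * \<kappa> * norm u)\<^sup>2"
    using pos by (intro mult_left_mono power_mono norm_Pair_le_kappa v) auto
  also have "\<dots> = 2 * \<kappa>\<^sup>2 * \<rho> * norm (?z - ?z') * (norm u)\<^sup>2"
    by (simp add: power_mult_distrib)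
  finally have "(u, v) \<bullet> hess f ?z (u, v)
      \<le> (u, v) \<bullet> hess f ?z' (u, v) + 2 * \<kappa>\<^sup>2 * \<rho> * norm (?z - ?z') * (norm u)\<^sup>2"
    by (simp add: inner_diff_right)
  then show ?thesis
    using hess_quadratic_le_minimax_hess[of u v x' y'] by (simp add: v(1))
qed

lemma minimax_hess_lipschitz:
  "\<bar>u \<bullet> (minimax_hess f x y *v u) - u \<bullet> (minimax_hess f x' y' *v u)\<bar>
     \<le> 2 * \<kappa>\<^sup>2 * \<rho> * norm ((x, y) - (x', y')) * (norm u)\<^sup>2"
  using minimax_hess_lipschitz_one_sided[of u x y x' y']
    minimax_hess_lipschitz_one_sided[of u x' y' x y]
  unfolding norm_minus_commute[of "(x', y')" "(x, y)"] by linarith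

section \<open>The inner maximiser and the primal function\<close>

text \<open>
  Strong concavity makes \<open>f (x, _)\<close> smaller than \<open>f (x, 0)\<close> outside a ball, and on that ball the
  maximum exists by compactness.
\<close>

lemma ex_maximiser: "\<exists>y0. \<forall>y. f (x, y) \<le> f (x, y0)"
proof -
  define R where "R = 2 * norm (grad_y f x 0) / \<mu>"
  have R: "0 \<le> R" using pos by (simp add: R_def)
  have cont: "continuous_on (cball 0 R) (\<lambda>y. f (x, y))"
    by (rule has_derivative_continuous_on) (rule has_derivative_at_withinI[OF has_derivative_f_y])
  have "cball (0::real^'m) R \<noteq> {}" using R by simp
  from continuous_attains_sup[OF compact_cball this cont]
  obtain y0 where "\<forall>y\<in>cball 0 R. f (x, y) \<le> f (x, y0)" by blast
  then have y0: "f (x, y) \<le> f (x, y0)" if "norm y \<le> R" for y using that by simp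
  have "f (x, y) \<le> f (x, y0)" if "R < norm y" for y
  proof -
    have "f (x, y) \<le> f (x, 0) + norm y * (norm (grad_y f x 0) - \<mu> / 2 * norm y)"
      using strongly_concave[of x y 0] norm_cauchy_schwarz[of "grad_y f x 0" y]
      by (simp add: power2_eq_square algebra_simps)
    also have "\<dots> \<le> f (x, 0)"
    proof -
      have "norm (grad_y f x 0) - \<mu> / 2 * norm y \<le> 0"
        using that pos by (simp add: R_def field_simps)
      then show ?thesis by (simp add: mult_nonneg_nonpos)
    qed
    also have "\<dots> \<le> f (x, y0)" using R by (intro y0) simp
    finally show ?thesis .
  qed
  with y0 show ?thesis by (metis not_le)
qed

lemma f_le_argmax: "f (x, y) \<le> f (x, argmax_y f x)"
proof -
  obtain y0 where "\<And>y. f (x, y) \<le> f (x, y0)" using ex_maximiser by blast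
  moreover from this have "f (x, argmax_y f x) = f (x, y0)"
    unfolding argmax_y_def
    by (intro arg_max_equality[where f = "\<lambda>y. f (x, y)"]) auto
  ultimately show ?thesis by simp
qed

lemma max_y_eq: "max_y f x = f (x, argmax_y f x)"
  unfolding max_y_def by (rule cSup_eq_maximum) (auto simp: f_le_argmax)

lemma grad_y_argmax: "snd (grad f (x, argmax_y f x)) = 0"
proof -
  have "(\<lambda>h. h \<bullet> snd (grad f (x, argmax_y f x))) = (\<lambda>h. 0)"
    by (rule differential_zero_maxmin[OF UNIV_I open_UNIV has_derivative_f_y])
      (auto simp: f_le_argmax)
  then show ?thesis by (metis inner_eq_zero_iff)
qed

text \<open>
  Adding the strong concavity inequalities between the two maximisers bounds \<open>\<mu> |d|\<^sup>2\<close> by a difference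
  of \<open>y\<close>-gradients at points that differ only in \<open>x\<close>.
\<close>

lemma argmax_lipschitz: "norm (argmax_y f x - argmax_y f x') \<le> \<kappa> * norm (x - x')"
proof -
  define y y' d where "y = argmax_y f x" and "y' = argmax_y f x'" and "d = y - y'"
  have "f (x', y) \<le> f (x', y') - \<mu> / 2 * (norm d)\<^sup>2"
    using strongly_concave[of x' y y'] by (simp add: grad_y_eq y'_def grad_y_argmax d_def)
  moreover have "f (x', y') \<le> f (x', y) + grad_y f x' y \<bullet> (y' - y) - \<mu> / 2 * (norm d)\<^sup>2"
    using strongly_concave[of x' y' y] by (simp add: d_def norm_minus_commute)
  ultimately have "\<mu> * (norm d)\<^sup>2 \<le> grad_y f x' y \<bullet> (y' - y)" by simp
  also have "\<dots> = snd (grad f (x', y) - grad f (x, y)) \<bullet> (y' - y)"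
    by (simp add: grad_y_eq y_def grad_y_argmax)
  also have "\<dots> \<le> norm (snd (grad f (x', y) - grad f (x, y))) * norm d"
    unfolding d_def norm_minus_commute[of y] by (rule norm_cauchy_schwarz)
  also have "\<dots> \<le> (L * norm ((x', y) - (x, y))) * norm d"
    by (intro mult_right_mono order_trans[OF norm_components_le(2) grad_lipschitz]) simp
  also have "norm ((x', y) - (x, y)) = norm (x - x')"
    by (simp add: norm_Pair norm_minus_commute)
  finally have "norm d * (\<mu> * norm d) \<le> norm d * (\<mu> * (\<kappa> * norm (x - x')))"
    by (simp add: L_eq power2_eq_square algebra_simps)
  then have "norm d \<le> \<kappa> * norm (x - x')"
    using pos kappa_ge_1 by (cases "d = 0") auto
  then show ?thesis by (simp add: d_def y_def y'_def)
qed

lemma norm_argmax_step_le: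
  "norm (s, argmax_y f (x + s) - argmax_y f x) \<le> sqrt 2 * \<kappa> * norm s"
  using argmax_lipschitz[of "x + s" x] by (intro norm_Pair_le_kappa) simp

lemma sqrt2_kappa_cube: "\<rho> * (sqrt 2 * \<kappa>) ^ 3 = M / 2"
  by (simp add: M power_mult_distrib power3_eq_cube)

text \<open>
  Third-order Taylor expansion of \<open>f\<close> along the curve of maximisers: the first-order term in \<open>y\<close>
  vanishes, and the second-order term is at most its maximum over \<open>y\<close>-directions, the Schur form.
\<close>

lemma max_y_cubic_upper:
  "max_y f (x + s) \<le> max_y f x + s \<bullet> grad_x f x (argmax_y f x)
     + 1/2 * (s \<bullet> (minimax_hess f x (argmax_y f x) *v s)) + M / 12 * norm s ^ 3"
proof -
  define y d where "y = argmax_y f x" and "d = argmax_y f (x + s) - y"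
  have "f ((x, y) + (s, d)) \<le> f (x, y) + (s, d) \<bullet> grad f (x, y)
      + 1/2 * ((s, d) \<bullet> hess f (x, y) (s, d)) + \<rho> / 6 * norm (s, d) ^ 3"
    by (rule taylor_upper)
  moreover have "(s, d) \<bullet> grad f (x, y) = s \<bullet> grad_x f x y"
    using grad_y_argmax[of x] by (simp add: inner_prod_def grad_x_eq y_def)
  moreover have "(s, d) \<bullet> hess f (x, y) (s, d) \<le> s \<bullet> (minimax_hess f x y *v s)"
    by (rule hess_quadratic_le_minimax_hess)
  moreover have "\<rho> / 6 * norm (s, d) ^ 3 \<le> M / 12 * norm s ^ 3"
  proof -
    have "\<rho> / 6 * norm (s, d) ^ 3 \<le> \<rho> / 6 * (sqrt 2 * \<kappa> * norm s) ^ 3"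
      using norm_argmax_step_le[of s x] pos
      by (intro mult_left_mono power_mono) (auto simp: d_def y_def)
    also have "\<dots> = (\<rho> * (sqrt 2 * \<kappa>) ^ 3) / 6 * norm s ^ 3"
      by (simp add: power_mult_distrib)
    finally show ?thesis unfolding sqrt2_kappa_cube by simp
  qed
  ultimately show ?thesis by (simp add: max_y_eq y_def d_def)
qed

text \<open>
  The error vector \<open>w\<close> is tested against itself. Its lift \<open>(w, v)\<close> turns \<open>w \<bullet> H s\<close> into the pairing with
  the full Hessian, while \<open>v\<close> does not see the gradients, whose \<open>y\<close>-parts vanish at both maximisers.
  What remains is the Taylor remainder of the gradient of \<open>f\<close>.
\<close>

lemma primal_grad_taylor:
  "norm (grad_x f (x + s) (argmax_y f (x + s)) - grad_x f x (argmax_y f x)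
      - minimax_hess f x (argmax_y f x) *v s) \<le> M / 4 * (norm s)\<^sup>2"
proof -
  define y d where "y = argmax_y f x" and "d = argmax_y f (x + s) - y"
  define R where "R = grad f ((x, y) + (s, d)) - grad f (x, y) - hess f (x, y) (s, d)"
  define w where "w = grad_x f (x + s) (argmax_y f (x + s)) - grad_x f x (argmax_y f x)
      - minimax_hess f x (argmax_y f x) *v s"
  obtain v where v: "hess f (x, y) (w, v) = (minimax_hess f x y *v w, 0)" "norm v \<le> \<kappa> * norm w"
    using hess_lift by blast
  have nsd: "norm (s, d) \<le> sqrt 2 * \<kappa> * norm s"
    using norm_argmax_step_le[of s x] by (simp add: d_def y_def)
  have "(w, v) \<bullet> hess f (x, y) (s, d) = (s, d) \<bullet> hess f (x, y) (w, v)" by (rule hess_symmetric)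
  also have "\<dots> = w \<bullet> (minimax_hess f x y *v s)"
    by (simp add: v minimax_hess_symmetric[of s])
  finally have "w \<bullet> w = (w, v) \<bullet> R"
    using grad_y_argmax[of x] grad_y_argmax[of "x + s"]
    by (simp add: R_def inner_diff_right d_def y_def)
      (simp add: w_def inner_prod_def inner_diff_right grad_x_eq)
  also have "\<dots> \<le> norm (w, v) * norm R" by (rule norm_cauchy_schwarz)
  also have "\<dots> \<le> (sqrt 2 * \<kappa> * norm w) * (\<rho> / 2 * (sqrt 2 * \<kappa> * norm s)\<^sup>2)"
  proof (rule mult_mono)
    show "norm (w, v) \<le> sqrt 2 * \<kappa> * norm w" by (rule norm_Pair_le_kappa) fact
    have "norm R \<le> \<rho> / 2 * (norm (s, d))\<^sup>2" unfolding R_def by (rule grad_taylor)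
    also have "\<dots> \<le> \<rho> / 2 * (sqrt 2 * \<kappa> * norm s)\<^sup>2"
      using nsd pos by (intro mult_left_mono power_mono) auto
    finally show "norm R \<le> \<rho> / 2 * (sqrt 2 * \<kappa> * norm s)\<^sup>2" .
  qed (use kappa_ge_1 in auto)
  also have "\<dots> = norm w * ((\<rho> * (sqrt 2 * \<kappa>) ^ 3) / 2 * (norm s)\<^sup>2)"
    by (simp add: power_mult_distrib power2_eq_square power3_eq_cube)
  finally have "norm w * norm w \<le> norm w * (M / 4 * (norm s)\<^sup>2)"
    unfolding sqrt2_kappa_cube by (simp add: power2_norm_eq_inner[symmetric] power2_eq_square)
  moreover have "0 \<le> M / 4 * (norm s)\<^sup>2" using M_pos by simp
  ultimately show ?thesis
    unfolding w_def[symmetric] by (cases "w = 0") auto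
qed

lemma agd_approximates_argmax:
  assumes "norm (y0 - argmax_y f x) \<le> D" "0 < \<delta>"
    and "K = \<lceil>2 * sqrt \<kappa> * ln (sqrt (\<kappa> + 1) / \<delta> * D)\<rceil>"
  shows "norm (agd (\<lambda>v. - f (x, v)) y0 K (1 / L) ((sqrt \<kappa> - 1) / (sqrt \<kappa> + 1)) - argmax_y f x) \<le> \<delta>"
proof -
  have deriv: "((\<lambda>v. - f (x, v)) has_derivative (\<lambda>d. d \<bullet> - snd (grad f (x, v)))) (at v)" for v
    using has_derivative_minus[OF has_derivative_f_y] by simp
  have g: "grad (\<lambda>v. - f (x, v)) v = - snd (grad f (x, v))" for v
    by (rule grad_eqI[OF deriv])
  have lip: "norm (- snd (grad f (x, v)) - - snd (grad f (x, v'))) \<le> L * norm (v - v')" for v v'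
  proof -
    have "norm (snd (grad f (x, v') - grad f (x, v))) \<le> L * norm ((x, v') - (x, v))"
      by (rule order_trans[OF norm_components_le(2) grad_lipschitz])
    then show ?thesis by (simp add: norm_Pair norm_minus_commute)
  qed
  show ?thesis
  proof (rule agd_accuracy[OF pos(3) mu_le_L kappa _ _ _ assms])
    show "- f (x, z + d) \<le> - f (x, z) + d \<bullet> grad (\<lambda>v. - f (x, v)) z + L / 2 * (norm d)\<^sup>2" for z d
      unfolding g by (rule value_le_of_lipschitz_gradient[OF deriv lip])
    show "- f (x, z) + d \<bullet> grad (\<lambda>v. - f (x, v)) z + \<mu> / 2 * (norm d)\<^sup>2 \<le> - f (x, z + d)" for z d
      using strongly_concave[of x "z + d" z] by (simp add: g grad_y_eq inner_commute)
    show "grad (\<lambda>v. - f (x, v)) (argmax_y f x) = 0"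
      by (simp add: g grad_y_argmax)
  qed
qed

section \<open>Inexact cubic Newton steps\<close>

text \<open>
  The error is at most \<open>2 \<kappa>\<^sup>2 \<rho> |y - y\<^sup>*|\<close> by Lipschitz continuity and at most \<open>3 \<kappa> L\<close> by boundedness.
  The geometric mean of the two is of order \<open>\<surd>(\<kappa>\<^sup>3 \<rho> e)\<close>, which is the scale of \<open>\<surd>(M e)\<close>. So one accuracy of order
  \<open>e / L\<close> controls the gradient and the Hessian, for every size of \<open>e\<close>.
\<close>

lemma inexact_minimax_hess:
  assumes near: "norm (y - argmax_y f x) \<le> e / (192 * L)"
  shows "\<bar>u \<bullet> (minimax_hess f x y *v u) - u \<bullet> (minimax_hess f x (argmax_y f x) *v u)\<bar>
           \<le> 1 / 12 * sqrt (M * e) * (norm u)\<^sup>2"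
proof -
  \<comment> \<open>\<open>min a b \<le> \<surd>(a b)\<close>, and in \<open>a b\<close> the factor \<open>L\<close> of \<open>b\<close> cancels against the assumed accuracy.\<close>
  define a b where "a = 2 * \<kappa>\<^sup>2 * \<rho> * norm (y - argmax_y f x)" and "b = 3 * \<kappa> * L"
  have e: "0 \<le> e"
  proof -
    have "0 \<le> e / (192 * L)" by (rule order_trans[OF norm_ge_zero near])
    then show ?thesis using pos by (simp add: zero_le_divide_iff)
  qed
  let ?E = "\<bar>u \<bullet> (minimax_hess f x y *v u) - u \<bullet> (minimax_hess f x (argmax_y f x) *v u)\<bar>"
  have ab: "0 \<le> a" "0 \<le> b" using pos kappa_ge_1 by (simp_all add: a_def b_def)
  have "?E \<le> a * (norm u)\<^sup>2"
    using minimax_hess_lipschitz[of u x y x "argmax_y f x"] by (simp add: a_def norm_Pair)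
  moreover have "?E \<le> b * (norm u)\<^sup>2"
    using minimax_hess_quadratic_le[of u x y] minimax_hess_quadratic_le[of u x "argmax_y f x"]
    unfolding b_def by linarith
  ultimately have E: "?E \<le> min a b * (norm u)\<^sup>2" by (simp add: min_def)
  have "min a b \<le> 1 / 12 * sqrt (M * e)"
  proof -
    have "(min a b)\<^sup>2 \<le> a * b"
      unfolding power2_eq_square using ab by (intro mult_mono) auto
    also have "a * b = 6 * (\<kappa> ^ 3 * \<rho> * L) * norm (y - argmax_y f x)"
      by (simp add: a_def b_def power2_eq_square power3_eq_cube)
    also have "\<dots> \<le> 6 * (\<kappa> ^ 3 * \<rho> * L) * (e / (192 * L))"
      using near pos kappa_ge_1 by (intro mult_left_mono) auto
    also have "\<dots> = \<kappa> ^ 3 * \<rho> * e * (1 / 32)" using pos by simp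
    also have "\<dots> \<le> \<kappa> ^ 3 * \<rho> * e * (4 * sqrt 2 / 144)"
    proof (intro mult_left_mono)
      have "9 / 8 \<le> sqrt (2::real)" by (rule real_le_rsqrt) (simp add: power2_eq_square)
      then show "1 / 32 \<le> 4 * sqrt 2 / (144::real)" by simp
    qed (use e pos kappa_ge_1 in auto)
    also have "\<dots> = (1 / 12 * sqrt (M * e))\<^sup>2"
      using e M_pos by (simp add: power_mult_distrib power_divide M)
    finally show ?thesis by (rule power2_le_imp_le) (use e M_pos in simp)
  qed
  then have "min a b * (norm u)\<^sup>2 \<le> 1 / 12 * sqrt (M * e) * (norm u)\<^sup>2"
    by (rule mult_right_mono) simp
  with E show ?thesis by (rule order_trans)
qed

lemma inexact_grad_x:
  assumes near: "norm (y - argmax_y f x) \<le> e / (192 * L)"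
  shows "norm (grad_x f x y - grad_x f x (argmax_y f x)) \<le> e / 192"
proof -
  have "norm (grad_x f x y - grad_x f x (argmax_y f x))
      \<le> norm (grad f (x, y) - grad f (x, argmax_y f x))"
    unfolding grad_x_eq fst_diff[symmetric] by (rule norm_components_le)
  also have "\<dots> \<le> L * norm ((x, y) - (x, argmax_y f x))" by (rule grad_lipschitz)
  also have "\<dots> \<le> L * (e / (192 * L))"
    using near pos by (intro mult_left_mono) (auto simp: norm_Pair)
  finally show ?thesis using pos by simp
qed

text \<open>
  The optimality conditions of the model give a predicted decrease of at least \<open>M/12 |s|\<^sup>3\<close>. The cubic
  term of the upper bound for \<open>P\<close> is only half of that of the model, which adds \<open>M/12 |s|\<^sup>3\<close>. For a long step
  the inexactness consumes at most \<open>(1/48 + 1/12) M |s|\<^sup>3\<close> of the total \<open>M/6 |s|\<^sup>3\<close>, so \<open>M/16 |s|\<^sup>3\<close> is left.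
\<close>

lemma long_step_decrease:
  assumes near: "norm (y - argmax_y f x) \<le> e / (192 * L)" and e: "0 < e"
    and min: "\<And>s'. cubic_model (grad_x f x y) (minimax_hess f x y) M s
                \<le> cubic_model (grad_x f x y) (minimax_hess f x y) M s'"
    and long: "1/2 * sqrt (e / M) < norm s"
  shows "max_y f (x + s) + e * sqrt e / (128 * sqrt M) \<le> max_y f x"
proof -
  define g H G Hs where "g = grad_x f x y" and "H = minimax_hess f x y"
    and "G = grad_x f x (argmax_y f x)" and "Hs = minimax_hess f x (argmax_y f x)"
  \<comment> \<open>In the scaled length \<open>m r\<close> the step is long iff \<open>p < 2 m r\<close>, and all error terms are homogeneous cubic
    polynomials in \<open>p\<close> and \<open>m r\<close>.\<close>
  define p m r where "p = sqrt e" and "m = sqrt M" and "r = norm s"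
  have p: "0 < p" "e = p\<^sup>2" and m: "0 < m" "M = m\<^sup>2"
    using e M_pos by (simp_all add: p_def m_def)
  note sym = minimax_hess_symmetric[of _ x y]
  have "s \<bullet> (g + H *v s + (M / 2 * r) *\<^sub>R s) = 0"
    unfolding g_def H_def r_def
    by (subst cubic_model_stationary[OF sym less_imp_le[OF M_pos] min]) simp
  then have stat: "s \<bullet> g + s \<bullet> (H *v s) + M / 2 * r ^ 3 = 0"
    by (simp add: inner_add_right power2_norm_eq_inner[symmetric] r_def power2_eq_square
        power3_eq_cube)
  have curv: "0 \<le> s \<bullet> (H *v s) + M / 2 * r ^ 3"
    using cubic_model_curvature[OF sym less_imp_le[OF M_pos] min, of s]
    by (simp add: H_def r_def power2_eq_square power3_eq_cube)
  have "max_y f (x + s) \<le> max_y f x + s \<bullet> G + 1/2 * (s \<bullet> (Hs *v s)) + M / 12 * r ^ 3"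
    unfolding G_def Hs_def r_def by (rule max_y_cubic_upper)
  moreover have "s \<bullet> G \<le> s \<bullet> g + r * (e / 192)"
  proof -
    have "s \<bullet> (G - g) \<le> r * norm (G - g)" unfolding r_def by (rule norm_cauchy_schwarz)
    also have "\<dots> \<le> r * (e / 192)"
      using inexact_grad_x[OF near]
      by (intro mult_left_mono) (auto simp: r_def G_def g_def norm_minus_commute)
    finally show ?thesis by (simp add: inner_diff_right)
  qed
  moreover have "s \<bullet> (Hs *v s) \<le> s \<bullet> (H *v s) + 1 / 12 * (m * p) * r\<^sup>2"
    using inexact_minimax_hess[OF near, of s]
    unfolding H_def Hs_def m_def p_def r_def real_sqrt_mult by linarith
  ultimately have "max_y f (x + s)
      \<le> max_y f x - 1 / 6 * (M * r ^ 3) + r * (e / 192) + 1 / 24 * (m * p) * r\<^sup>2"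
    using stat curv by linarith
  then have "m * max_y f (x + s) \<le> m * (max_y f x - 1 / 6 * (M * r ^ 3) + r * (e / 192)
      + 1 / 24 * (m * p) * r\<^sup>2)"
    using m by (intro mult_left_mono) auto
  also have "\<dots> = m * max_y f x - (m * r) ^ 3 / 6 + p\<^sup>2 * (m * r) / 192 + p * (m * r)\<^sup>2 / 24"
    by (simp add: p m power2_eq_square power3_eq_cube field_simps)
  also have "\<dots> \<le> m * max_y f x - p ^ 3 / 128"
  proof -
    define q where "q = m * r"
    have "1/2 * (p / m) < r" using long by (simp add: p_def m_def r_def real_sqrt_divide)
    then have pq: "p \<le> 2 * q" using m by (simp add: q_def field_simps)
    then have q: "0 < q" using p by simp
    have "p\<^sup>2 * q \<le> (2 * q)\<^sup>2 * q" "p * q\<^sup>2 \<le> (2 * q) * q\<^sup>2" "p ^ 3 \<le> (2 * q) ^ 3"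
      using pq p(1) q by (intro mult_right_mono power_mono; simp)+
    then show ?thesis
      unfolding q_def[symmetric] by (simp add: power2_eq_square power3_eq_cube)
  qed
  finally have "m * max_y f (x + s) \<le> m * max_y f x - p ^ 3 / 128" .
  moreover have "m * (max_y f (x + s) + p ^ 3 / (128 * m)) = m * max_y f (x + s) + p ^ 3 / 128"
    using m(1) by (simp add: distrib_left)
  ultimately have "m * (max_y f (x + s) + p ^ 3 / (128 * m)) \<le> m * max_y f x" by linarith
  then have "max_y f (x + s) + p ^ 3 / (128 * m) \<le> max_y f x" using m(1) by simp
  moreover have "p ^ 3 = e * sqrt e" using e by (simp add: p_def power3_eq_cube)
  ultimately show ?thesis by (simp add: m_def)
qed

text \<open>
  At the new point the gradient is the sum of the Taylor error, the two inexactness errors and the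
  residual \<open>- M/2 |s| s\<close> of the model; for a short step these are all multiples of \<open>e\<close>. For the
  curvature, \<open>M/2 |s|\<close> is lost once in the model and once more in moving from \<open>x\<close> to \<open>x + s\<close>,
  besides the inexactness of \<open>H\<close>.
\<close>

lemma short_step_stationary:
  assumes near: "norm (y - argmax_y f x) \<le> e / (192 * L)" and e: "0 < e"
    and min: "\<And>s'. cubic_model (grad_x f x y) (minimax_hess f x y) M s
                \<le> cubic_model (grad_x f x y) (minimax_hess f x y) M s'"
    and short: "norm s \<le> 1/2 * sqrt (e / M)"
  shows "norm (grad_x f (x + s) (argmax_y f (x + s))) \<le> e"
    and "- (sqrt (M * e) * (norm u)\<^sup>2)
           \<le> u \<bullet> (minimax_hess f (x + s) (argmax_y f (x + s)) *v u)"
proof -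
  define g H G Hs where "g = grad_x f x y" and "H = minimax_hess f x y"
    and "G = grad_x f x (argmax_y f x)" and "Hs = minimax_hess f x (argmax_y f x)"
  define G' H' where "G' = grad_x f (x + s) (argmax_y f (x + s))"
    and "H' = minimax_hess f (x + s) (argmax_y f (x + s))"
  define p m r where "p = sqrt e" and "m = sqrt M" and "r = norm s"
  have p: "0 < p" "e = p\<^sup>2" and m: "0 < m" "M = m\<^sup>2"
    using e M_pos by (simp_all add: p_def m_def)
  have mp: "sqrt (M * e) = m * p" by (simp add: m_def p_def real_sqrt_mult)
  have r0: "0 \<le> r" by (simp add: r_def)
  have q: "m * r \<le> p / 2"
  proof -
    have "r \<le> 1/2 * (p / m)" using short by (simp add: p_def m_def r_def real_sqrt_divide)
    then show ?thesis using m(1) by (simp add: field_simps)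
  qed
  note sym = minimax_hess_symmetric[of _ x y]
  have "g + H *v s = - ((M / 2 * r) *\<^sub>R s)"
    using cubic_model_stationary[OF sym less_imp_le[OF M_pos] min]
    by (simp add: g_def H_def r_def add_eq_0_iff2)
  then have stat: "norm (g + H *v s) = M / 2 * r\<^sup>2"
    using M_pos by (simp add: r_def power2_eq_square)
  have E: "norm ((Hs - H) *v s) \<le> 1 / 12 * (m * p) * r"
    unfolding r_def
  proof (rule symmetric_bound_imp_norm_bound)
    show "linear ((*v) (Hs - H))" by (rule matrix_vector_mul_linear)
    show "u \<bullet> ((Hs - H) *v v) = v \<bullet> ((Hs - H) *v u)" for u v
      by (simp add: matrix_vector_mult_diff_rdistrib inner_diff_right Hs_def H_def
          minimax_hess_symmetric[of u _ _ v])
    show "\<bar>u \<bullet> ((Hs - H) *v u)\<bar> \<le> 1 / 12 * (m * p) * (norm u)\<^sup>2" for u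
      using inexact_minimax_hess[OF near, of u]
      by (simp add: matrix_vector_mult_diff_rdistrib inner_diff_right Hs_def H_def mp
          abs_minus_commute)
  qed
  have "norm G' = norm ((G' - G - Hs *v s) + (G - g) + (Hs - H) *v s + (g + H *v s))"
    by (simp add: matrix_vector_mult_diff_rdistrib)
  then have "norm G' \<le> norm (G' - G - Hs *v s) + norm (G - g) + norm ((Hs - H) *v s)
      + norm (g + H *v s)"
    using norm_triangle_ineq[of "G' - G - Hs *v s + (G - g) + (Hs - H) *v s" "g + H *v s"]
      norm_triangle_ineq[of "G' - G - Hs *v s + (G - g)" "(Hs - H) *v s"]
      norm_triangle_ineq[of "G' - G - Hs *v s" "G - g"]
    by linarith
  moreover have "norm (G' - G - Hs *v s) \<le> M / 4 * r\<^sup>2"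
    unfolding G'_def G_def Hs_def r_def by (rule primal_grad_taylor)
  moreover have "norm (G - g) \<le> e / 192"
    using inexact_grad_x[OF near] by (simp add: G_def g_def norm_minus_commute)
  ultimately have "norm G' \<le> M / 4 * r\<^sup>2 + e / 192 + 1 / 12 * (m * p) * r + M / 2 * r\<^sup>2"
    using E stat by linarith
  also have "\<dots> = 3 / 4 * (m * r)\<^sup>2 + p\<^sup>2 / 192 + p * (m * r) / 12"
    by (simp add: p m power_mult_distrib)
  also have "\<dots> \<le> p\<^sup>2"
  proof -
    have "(m * r)\<^sup>2 \<le> (p / 2)\<^sup>2" using q m r0 by (intro power_mono) auto
    moreover have "p * (m * r) \<le> p * (p / 2)" using q p by (intro mult_left_mono) auto
    moreover have "(p / 2)\<^sup>2 = p\<^sup>2 / 4" "p * (p / 2) = p\<^sup>2 / 2" "0 \<le> p\<^sup>2"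
      by (simp_all add: power2_eq_square)
    ultimately show ?thesis by linarith
  qed
  finally show "norm (grad_x f (x + s) (argmax_y f (x + s))) \<le> e" by (simp add: G'_def p)
  have "u \<bullet> (Hs *v u) \<le> u \<bullet> (H' *v u) + M / 2 * r * (norm u)\<^sup>2"
  proof -
    let ?d = "norm ((x, argmax_y f x) - (x + s, argmax_y f (x + s)))"
    have "?d \<le> sqrt 2 * \<kappa> * r"
      using norm_argmax_step_le[of s x] by (simp add: r_def norm_Pair norm_minus_commute)
    then have "2 * \<kappa>\<^sup>2 * \<rho> * ?d \<le> 2 * \<kappa>\<^sup>2 * \<rho> * (sqrt 2 * \<kappa> * r)"
      using pos by (intro mult_left_mono) auto
    also have "\<dots> = M / 2 * r" by (simp add: M power2_eq_square power3_eq_cube)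
    finally have "2 * \<kappa>\<^sup>2 * \<rho> * ?d * (norm u)\<^sup>2 \<le> M / 2 * r * (norm u)\<^sup>2"
      by (rule mult_right_mono) simp
    then show ?thesis
      using minimax_hess_lipschitz_one_sided[of u x "argmax_y f x" "x + s" "argmax_y f (x + s)"]
      by (simp add: Hs_def H'_def)
  qed
  moreover have "u \<bullet> (H *v u) \<le> u \<bullet> (Hs *v u) + 1 / 12 * (m * p) * (norm u)\<^sup>2"
    using inexact_minimax_hess[OF near, of u] unfolding H_def Hs_def mp by linarith
  moreover have "0 \<le> u \<bullet> (H *v u) + M / 2 * r * (norm u)\<^sup>2"
    using cubic_model_curvature[OF sym less_imp_le[OF M_pos] min, of u] by (simp add: H_def r_def)
  ultimately have "- ((M * r + 1 / 12 * (m * p)) * (norm u)\<^sup>2) \<le> u \<bullet> (H' *v u)"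
    by (simp add: algebra_simps)
  moreover have "(M * r + 1 / 12 * (m * p)) * (norm u)\<^sup>2 \<le> (m * p) * (norm u)\<^sup>2"
  proof (rule mult_right_mono)
    have "M * r = m * (m * r)" by (simp add: m power2_eq_square)
    also have "\<dots> \<le> m * (p / 2)" using q m by (intro mult_left_mono) auto
    finally show "M * r + 1 / 12 * (m * p) \<le> m * p"
      using mult_pos_pos[OF m(1) p(1)] by simp
  qed simp
  ultimately show "- (sqrt (M * e) * (norm u)\<^sup>2)
      \<le> u \<bullet> (minimax_hess f (x + s) (argmax_y f (x + s)) *v u)"
    unfolding mp H'_def by linarith
qed

section \<open>Runs of the minimax cubic Newton method\<close>

text \<open>
  Warm start: after a step \<open>s\<close> the previous \<open>y\<close> is within \<open>\<delta> + \<kappa> |s|\<close> of the new maximiser, which is the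
  distance assumed in the next iteration number.
\<close>

lemma mcn_inner_accuracy:
  assumes run: "mcn_run f L \<kappa> M e T K x0 x y s t" and \<delta>: "0 < \<delta>"
    and K0: "K 0 = \<lceil>2 * sqrt \<kappa> * ln (sqrt (\<kappa> + 1) / \<delta> * norm (argmax_y f x0))\<rceil>"
    and KSuc: "\<And>k. K (Suc k) =
                 \<lceil>2 * sqrt \<kappa> * ln (sqrt (\<kappa> + 1) / \<delta> * (\<delta> + \<kappa> * norm (s k)))\<rceil>"
    and "k \<le> t"
  shows "norm (y k - argmax_y f (x k)) \<le> \<delta>"
  using \<open>k \<le> t\<close>
proof (induction k)
  case 0
  have "x 0 = x0" "y 0 = agd (\<lambda>v. - f (x 0, v)) 0 (K 0) (1 / L) ((sqrt \<kappa> - 1) / (sqrt \<kappa> + 1))"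
    using run unfolding mcn_run_def by auto
  then show ?case
    using agd_approximates_argmax[OF _ \<delta> K0, of 0 x0] by simp
next
  case (Suc k)
  then have IH: "norm (y k - argmax_y f (x k)) \<le> \<delta>" by simp
  have ySuc: "y (Suc k) = agd (\<lambda>v. - f (x (Suc k), v)) (y k) (K (Suc k)) (1 / L)
      ((sqrt \<kappa> - 1) / (sqrt \<kappa> + 1))"
    and xSuc: "x (Suc k) = x k + s k"
    using run Suc.prems unfolding mcn_run_def by auto
  have "norm (y k - argmax_y f (x (Suc k)))
      \<le> norm (y k - argmax_y f (x k)) + norm (argmax_y f (x k) - argmax_y f (x (Suc k)))"
    using norm_triangle_ineq[of "y k - argmax_y f (x k)" "argmax_y f (x k) - argmax_y f (x (Suc k))"]
    by simp
  also have "\<dots> \<le> \<delta> + \<kappa> * norm (s k)"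
    using IH argmax_lipschitz[of "x k" "x (Suc k)"] by (simp add: xSuc)
  finally show ?case
    unfolding ySuc by (rule agd_approximates_argmax[OF _ \<delta> KSuc])
qed

text \<open>
  Otherwise all \<open>T\<close> steps are long and decrease \<open>P\<close> by more than \<open>P x0 - Pinf\<close> in total. The additional
  iteration in \<open>T\<close> makes the contradiction strict even if \<open>P x0 = Pinf\<close>.
\<close>

lemma mcn_last_step_short:
  assumes run: "mcn_run f L \<kappa> M e T K x0 x y s t" and e: "0 < e"
    and near: "\<And>k. k \<le> t \<Longrightarrow> norm (y k - argmax_y f (x k)) \<le> e / (192 * L)"
    and bdd: "bdd_below (range (max_y f))" and Pinf: "Pinf = (INF x. max_y f x)"
    and T: "T = nat (\<lceil>192 * (max_y f x0 - Pinf) * sqrt M * e powr (- 3 / 2)\<rceil> + 1)"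
  shows "norm (s t) \<le> 1/2 * sqrt (e / M)"
proof (rule ccontr)
  assume not_short: "\<not> ?thesis"
  note run' = run[unfolded mcn_run_def is_arg_min_linorder]
  have x0: "x 0 = x0" and SucT: "Suc t = T"
    using run' not_short by blast+
  have min: "cubic_model (grad_x f (x k) (y k)) (minimax_hess f (x k) (y k)) M (s k)
      \<le> cubic_model (grad_x f (x k) (y k)) (minimax_hess f (x k) (y k)) M s'" if "k \<le> t" for k s'
    using run' that by blast
  have step: "x (Suc k) = x k + s k" and long_before: "\<not> norm (s k) \<le> 1/2 * sqrt (e / M)"
    if "k < t" for k
    using run' that by blast+
  have long: "1/2 * sqrt (e / M) < norm (s k)" if "k \<le> t" for k
    using that long_before[of k] not_short by (cases "k = t") auto
  define c where "c = e * sqrt e / sqrt M"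
  have c: "0 < c" using e M_pos by (simp add: c_def)
  have dec: "max_y f (x k + s k) + c / 128 \<le> max_y f (x k)" if "k \<le> t" for k
    using long_step_decrease[OF near[OF that] e min[OF that] long[OF that]] by (simp add: c_def)
  have "max_y f (x k) + real k * (c / 128) \<le> max_y f x0" if "k \<le> t" for k
    using that
  proof (induction k)
    case (Suc k)
    then show ?case using dec[of k] step[of k] by (simp add: field_simps)
  qed (simp add: x0)
  from this[of t] dec[of t] have total: "max_y f (x t + s t) + real T * (c / 128) \<le> max_y f x0"
    by (simp add: SucT[symmetric] field_simps)
  have inf: "Pinf \<le> max_y f z" for z unfolding Pinf by (rule cINF_lower[OF bdd]) simp
  have "e powr (- 3 / 2) = 1 / (e * sqrt e)"
  proof -
    have "e powr (3 / 2) = e powr 1 * e powr (1 / 2)" unfolding powr_add[symmetric] by simp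
    then show ?thesis using e by (simp add: powr_minus_divide powr_half_sqrt)
  qed
  then have "sqrt M * e powr (- 3 / 2) = 1 / c" by (simp add: c_def)
  then have T': "T = nat (\<lceil>192 * (max_y f x0 - Pinf) * (1 / c)\<rceil> + 1)"
    unfolding T by (simp add: mult.assoc)
  have "192 * (max_y f x0 - Pinf) * (1 / c) + 1 \<le> real T" unfolding T' by linarith
  then have "(192 * (max_y f x0 - Pinf) * (1 / c) + 1) * c \<le> real T * c"
    using c by (intro mult_right_mono) auto
  moreover have "(192 * (max_y f x0 - Pinf) * (1 / c) + 1) * c = 192 * (max_y f x0 - Pinf) + c"
    using c by (simp add: distrib_right)
  ultimately have "192 * (max_y f x0 - Pinf) + c \<le> real T * c" by linarith
  with total inf[of "x t + s t"] inf[of x0] c show False by (simp add: field_simps)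
qed

end

section \<open>The minimax guarantee\<close>

theorem corollary2:
  fixes f :: "(real^'n) \<times> (real^'m) \<Rightarrow> real"
    and L \<rho> \<mu> \<kappa> \<alpha> \<beta> \<gamma> M Cg CH \<epsilon> \<epsilon>' \<epsilon>t Pinf :: real
    and x0 xh :: "real^'n" and yh :: "real^'m"
    and x s :: "nat \<Rightarrow> real^'n" and y :: "nat \<Rightarrow> real^'m"
    and T t :: nat and K :: "nat \<Rightarrow> int" and Kh :: int
  assumes pos: "L > 0" "\<rho> > 0" "\<mu> > 0"
    and diff: "twice_differentiable f"
    and A1: "\<And>x x' y y'. (norm (grad f (x, y) - grad f (x', y')))\<^sup>2
               \<le> L\<^sup>2 * ((norm (x - x'))\<^sup>2 + (norm (y - y'))\<^sup>2)"
    and A2: "\<And>x x' y y'. (onorm (\<lambda>w. hess f (x, y) w - hess f (x', y') w))\<^sup>2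
               \<le> \<rho>\<^sup>2 * ((norm (x - x'))\<^sup>2 + (norm (y - y'))\<^sup>2)"
    and A3: "\<And>x y y'. f (x, y) \<le> f (x, y') + grad_y f x y' \<bullet> (y - y')
               - \<mu> / 2 * (norm (y - y'))\<^sup>2"
    and A4: "bdd_below (range (max_y f))"
    and Pinf: "Pinf = (INF x. max_y f x)"
    and kappa: "\<kappa> = L / \<mu>"
    and strict_pos: "\<alpha> > 0" "\<beta> > 0" "\<gamma> > 0"
    and strict: "strict_minimax f \<alpha> \<beta> \<gamma>"
    and M: "M = 4 * sqrt 2 * \<kappa> ^ 3 * \<rho>"
    and Cg: "Cg = 1 / 192"
    and CH: "CH = 1 / 48"
    and eps: "\<epsilon> = min (\<alpha> / 3) (\<beta>\<^sup>2 / (8 * \<kappa> ^ 3 * \<rho>))"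
    and eps': "\<epsilon>' = 2 powr (- 5 / 2) * \<epsilon>"
    and epst: "\<epsilon>t = min (Cg * \<epsilon>' / L) (CH * sqrt (M * \<epsilon>') / \<rho>)"
    and T: "T = nat (\<lceil>192 * (max_y f x0 - Pinf) * sqrt M * \<epsilon>' powr (- 3 / 2)\<rceil> + 1)"
    and K0: "K 0 = \<lceil>2 * sqrt \<kappa> * ln (sqrt (\<kappa> + 1) / \<epsilon>t * norm (argmax_y f x0))\<rceil>"
    and KSuc: "\<And>k. K (Suc k) =
                 \<lceil>2 * sqrt \<kappa> * ln (sqrt (\<kappa> + 1) / \<epsilon>t * (\<epsilon>t + \<kappa> * norm (s k)))\<rceil>"
    and run: "mcn_run f L \<kappa> M \<epsilon>' T K x0 x y s t"
    and xh: "xh = x t + s t"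
    and Kh: "Kh = \<lceil>2 * sqrt \<kappa> *
                 ln (sqrt (\<kappa> + 1) * (\<epsilon>t + \<kappa> / 2 powr (9 / 4) * sqrt (\<epsilon> / M))
                     / min (\<alpha> / (2 * L)) (\<beta> / (8 * \<kappa>\<^sup>2 * \<rho>)))\<rceil>"
    and yh: "yh = agd (\<lambda>v. - f (xh, v)) (y t) Kh (1 / L) ((sqrt \<kappa> - 1) / (sqrt \<kappa> + 1))"
  shows "\<exists>xs ys. local_minimax_point f xs ys \<and>
           (norm (xs - xh))\<^sup>2 + (norm (ys - yh))\<^sup>2 \<le> \<gamma>\<^sup>2"
proof -
  interpret smooth_strongly_concave f L \<rho> \<mu> \<kappa> M
    by unfold_locales (fact pos diff A1 A2 A3 kappa M)+
  have k1: "1 \<le> \<kappa>" by (rule kappa_ge_1)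
  have e0: "0 < \<epsilon>" using strict_pos pos k1 by (simp add: eps)
  then have e'0: "0 < \<epsilon>'" by (simp add: eps')
  have t0: "0 < \<epsilon>t" using e'0 pos M_pos by (simp add: epst Cg CH)
  have eps_eps': "\<epsilon> = 4 * sqrt 2 * \<epsilon>'"
  proof -
    have "(2::real) powr (5 / 2) = 2 powr 2 * 2 powr (1 / 2)" unfolding powr_add[symmetric] by simp
    then have "(2::real) powr (5 / 2) = 4 * sqrt 2" by (simp add: powr_half_sqrt)
    moreover have "(2::real) powr (- 5 / 2) = 1 / 2 powr (5 / 2)" by (simp add: powr_minus_divide)
    ultimately show ?thesis by (simp add: eps')
  qed
  have alpha: "3 * \<epsilon>' \<le> \<alpha>"
  proof -
    have "1 \<le> sqrt (2::real)" by simp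
    then have "1 \<le> 4 * sqrt (2::real)" by linarith
    then have "\<epsilon>' \<le> \<epsilon>" using e'0 by (simp add: eps_eps')
    then show ?thesis using eps by simp
  qed
  have beta: "sqrt (M * \<epsilon>') \<le> \<beta> / 2"
  proof (rule real_le_lsqrt)
    have "\<epsilon> \<le> \<beta>\<^sup>2 / (8 * \<kappa> ^ 3 * \<rho>)" by (simp add: eps)
    then have "(8 * \<kappa> ^ 3 * \<rho>) * \<epsilon> \<le> \<beta>\<^sup>2"
      using pos k1 by (simp add: pos_le_divide_eq mult.commute)
    then have "8 * (M * \<epsilon>') \<le> \<beta>\<^sup>2"
      by (simp add: eps_eps' M mult.assoc mult.left_commute)
    then show "M * \<epsilon>' \<le> (\<beta> / 2)\<^sup>2"
      using mult_pos_pos[OF M_pos e'0] by (simp add: power_divide)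
  qed (use strict_pos in simp)
  have near: "norm (y k - argmax_y f (x k)) \<le> \<epsilon>t" if "k \<le> t" for k
    by (rule mcn_inner_accuracy[OF run t0 K0 KSuc that])
  have near': "norm (y k - argmax_y f (x k)) \<le> \<epsilon>' / (192 * L)" if "k \<le> t" for k
    by (rule order_trans[OF near[OF that]]) (simp add: epst Cg)
  have short: "norm (s t) \<le> 1/2 * sqrt (\<epsilon>' / M)"
    by (rule mcn_last_step_short[OF run e'0 near' A4 Pinf T])
  have min: "cubic_model (grad_x f (x t) (y t)) (minimax_hess f (x t) (y t)) M (s t)
      \<le> cubic_model (grad_x f (x t) (y t)) (minimax_hess f (x t) (y t)) M s'" for s'
    using run[unfolded mcn_run_def is_arg_min_linorder] by blast
  note stationary = short_step_stationary[OF near'[OF order_refl] e'0 min short, folded xh]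
  define \<delta> where "\<delta> = min (\<alpha> / (2 * L)) (\<beta> / (8 * \<kappa>\<^sup>2 * \<rho>))"
  have d0: "0 < \<delta>" using strict_pos pos k1 by (simp add: \<delta>_def)
  \<comment> \<open>The radius of a short step, expressed by \<open>\<epsilon>\<close> as in the iteration number \<open>Kh\<close>.\<close>
  have radius: "1/2 * sqrt (\<epsilon>' / M) = 1 / 2 powr (9 / 4) * sqrt (\<epsilon> / M)"
  proof -
    have "sqrt (\<epsilon>' / M) = sqrt (2 powr (- 5 / 2)) * sqrt (\<epsilon> / M)"
      by (simp add: eps' real_sqrt_mult[symmetric])
    also have "sqrt (2 powr (- 5 / 2)) = (2::real) powr (- 5 / 4)"
      by (simp add: powr_half_sqrt[symmetric] powr_powr)
    finally have "1/2 * sqrt (\<epsilon>' / M) = 2 powr (-1) * 2 powr (- 5 / 4) * sqrt (\<epsilon> / M)"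
      by (simp add: powr_minus_divide)
    also have "(2::real) powr (-1) * 2 powr (- 5 / 4) = 1 / 2 powr (9 / 4)"
      unfolding powr_add[symmetric] by (simp add: powr_minus_divide[symmetric])
    finally show ?thesis .
  qed
  have "norm (y t - argmax_y f xh)
      \<le> norm (y t - argmax_y f (x t)) + norm (argmax_y f (x t) - argmax_y f xh)"
    using norm_triangle_ineq[of "y t - argmax_y f (x t)" "argmax_y f (x t) - argmax_y f xh"]
    by simp
  also have "\<dots> \<le> \<epsilon>t + \<kappa> * norm (s t)"
    using near[of t] argmax_lipschitz[of "x t" xh] by (simp add: xh)
  also have "\<dots> \<le> \<epsilon>t + \<kappa> * (1 / 2 powr (9 / 4) * sqrt (\<epsilon> / M))"
    using short k1 unfolding radius by (intro add_left_mono mult_left_mono) auto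
  finally have start: "norm (y t - argmax_y f xh) \<le> \<epsilon>t + \<kappa> / 2 powr (9 / 4) * sqrt (\<epsilon> / M)"
    by simp
  have yh_near: "norm (yh - argmax_y f xh) \<le> \<delta>"
    unfolding yh
    by (rule agd_approximates_argmax[OF start d0]) (simp add: Kh \<delta>_def)
  have "norm (grad f (xh, yh)) \<le> \<alpha>"
  proof -
    have "grad f (xh, argmax_y f xh) = (grad_x f xh (argmax_y f xh), 0)"
      by (simp add: prod_eq_iff grad_x_eq grad_y_argmax)
    then have "norm (grad f (xh, argmax_y f xh)) \<le> \<epsilon>'" using stationary(1) by (simp add: norm_Pair)
    moreover have "norm (grad f (xh, yh) - grad f (xh, argmax_y f xh)) \<le> \<alpha> / 2"
    proof -
      have "norm (grad f (xh, yh) - grad f (xh, argmax_y f xh)) \<le> L * norm ((xh, yh) - (xh, argmax_y f xh))"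
        by (rule grad_lipschitz)
      also have "\<dots> \<le> L * (\<alpha> / (2 * L))"
        using yh_near pos by (intro mult_left_mono) (auto simp: norm_Pair \<delta>_def)
      finally show ?thesis using pos by simp
    qed
    ultimately show ?thesis
      using norm_triangle_ineq2[of "grad f (xh, yh)" "grad f (xh, argmax_y f xh)"] alpha strict_pos
      by linarith
  qed
  moreover have "- \<beta> \<le> lambda_min (minimax_hess f xh yh)"
  proof (rule lambda_min_ge[OF minimax_hess_symmetric])
    fix u :: "real^'n"
    have "2 * \<kappa>\<^sup>2 * \<rho> * norm ((xh, argmax_y f xh) - (xh, yh)) \<le> 2 * \<kappa>\<^sup>2 * \<rho> * (\<beta> / (8 * \<kappa>\<^sup>2 * \<rho>))"
      using yh_near pos by (intro mult_left_mono) (auto simp: norm_Pair \<delta>_def norm_minus_commute)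
    also have "\<dots> = \<beta> / 4" using pos k1 by simp
    finally have "2 * \<kappa>\<^sup>2 * \<rho> * norm ((xh, argmax_y f xh) - (xh, yh)) * (norm u)\<^sup>2 \<le> \<beta> / 4 * (norm u)\<^sup>2"
      by (rule mult_right_mono) simp
    then have "u \<bullet> (minimax_hess f xh (argmax_y f xh) *v u)
        \<le> u \<bullet> (minimax_hess f xh yh *v u) + \<beta> / 4 * (norm u)\<^sup>2"
      using minimax_hess_lipschitz_one_sided[of u xh "argmax_y f xh" xh yh] by linarith
    moreover have "sqrt (M * \<epsilon>') * (norm u)\<^sup>2 \<le> \<beta> / 2 * (norm u)\<^sup>2"
      by (rule mult_right_mono[OF beta]) simp
    moreover have "0 \<le> \<beta> * (norm u)\<^sup>2" using strict_pos by simp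
    ultimately show "- \<beta> * (norm u)\<^sup>2 \<le> u \<bullet> (minimax_hess f xh yh *v u)"
      using stationary(2)[of u] by simp
  qed
  ultimately have "\<not> norm (grad f (xh, yh)) > \<alpha>"
    "\<not> lambda_min (minimax_hess f xh yh) < - \<beta>"
    by linarith+
  with strict obtain xs ys where close: "local_minimax_point f xs ys"
    "(norm (xh - xs))\<^sup>2 + (norm (yh - ys))\<^sup>2 \<le> \<gamma>\<^sup>2"
    unfolding strict_minimax_def by blast
  show ?thesis
    by (intro exI[of _ xs] exI[of _ ys])
      (use close in \<open>simp add: norm_minus_commute[of xs xh] norm_minus_commute[of ys yh]\<close>)
qed

end
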